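(* Let $\sigma$ be a permutation of $\mathbb{N}_0$, let $1<p<\infty$ and let $p'$ be given by $1/p+1/p'=1$. Then the systems $(e_k)_{k\ge0}$ and $(w_{\sigma(k)})_{k\ge0}$ are equivalent in $L_p$ if and only if they are equivalent in $L_{p'}$.
   Context: $\mathbb{N}_0=\{0,1,2,\ldots\}$. On $[0,1]$, $e_n(t)=\exp(2\pi i n t)$; $r_0,r_1,\ldots$ are the Rademacher functions ($r_i(t)=\operatorname{sign}\sin(2^{i+1}\pi t)$), and for $n=\sum_{i\ge0}n_i2^i$ with $n_i\in\{0,1\}$ the $n$-th Walsh function is $w_n=\prod_{i\ge 0} r_i^{n_i}$. Two systems $(a_k)_{k\ge0}$, $(b_k)_{k\ge0}$ in $L_p[0,1]$ are equivalent in $L_p$ if there is $c>0$ such that $\frac1c\|\sum_k\xi_k a_k\|_p\le\|\sum_k\xi_k b_k\|_p\le c\|\sum_k\xi_k a_k\|_p$ for all complex sequences $(\xi_k)_{k\ge0}$ with finitely many nonzero terms; $\|\cdot\|_p$ is the norm of $L_p[0,1]$. *)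

theory Defs
  imports "HOL-Analysis.Analysis"
begin

definition in_Lp :: "real \<Rightarrow> (real \<Rightarrow> complex) \<Rightarrow> bool" where
  "in_Lp p f \<longleftrightarrow>
     f \<in> borel_measurable (lebesgue_on {0..1}) \<and>
     integrable (lebesgue_on {0..1}) (\<lambda>t. norm (f t) powr p)"

(* Meaningful for functions satisfying in_Lp; the Bochner integral of a non-integrable
   function is 0. *)
definition Lp_norm :: "real \<Rightarrow> (real \<Rightarrow> complex) \<Rightarrow> real" where
  "Lp_norm p f = (\<integral>t. norm (f t) powr p \<partial>lebesgue_on {0..1}) powr (1 / p)"

definition trig :: "nat \<Rightarrow> real \<Rightarrow> complex" where
  "trig n t = exp (2 * of_real pi * \<i> * of_nat n * of_real t)"

definition rademacher :: "nat \<Rightarrow> real \<Rightarrow> real" where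
  "rademacher i t = sgn (sin (2 ^ (i + 1) * pi * t))"

(* The product over all i of r_i ^ n_i, where n_i is the i-th binary digit of n; only the
   finitely many factors with n_i = 1 are kept. *)
definition walsh :: "nat \<Rightarrow> real \<Rightarrow> complex" where
  "walsh n t = of_real (\<Prod>i\<in>{i. bit n i}. rademacher i t)"

definition equivalent_in_Lp ::
    "real \<Rightarrow> (nat \<Rightarrow> real \<Rightarrow> complex) \<Rightarrow> (nat \<Rightarrow> real \<Rightarrow> complex) \<Rightarrow> bool" where
  "equivalent_in_Lp p a b \<longleftrightarrow>
     (\<forall>k. in_Lp p (a k)) \<and> (\<forall>k. in_Lp p (b k)) \<and>
     (\<exists>c>0. \<forall>\<xi> :: nat \<Rightarrow> complex. finite {k. \<xi> k \<noteq> 0} \<longrightarrow>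
        1 / c * Lp_norm p (\<lambda>t. \<Sum>k | \<xi> k \<noteq> 0. \<xi> k * a k t)
          \<le> Lp_norm p (\<lambda>t. \<Sum>k | \<xi> k \<noteq> 0. \<xi> k * b k t) \<and>
        Lp_norm p (\<lambda>t. \<Sum>k | \<xi> k \<noteq> 0. \<xi> k * b k t)
          \<le> c * Lp_norm p (\<lambda>t. \<Sum>k | \<xi> k \<noteq> 0. \<xi> k * a k t))"

end

theory Submission
  imports Defs "HOL-Complex_Analysis.Complex_Analysis"
begin

text \<open>
  By symmetry in the two conjugate exponents, which are called \<open>p\<close> and \<open>q\<close> below, it suffices
  to carry the equivalence from \<open>L\<^sub>p\<close> over to \<open>L\<^sub>q\<close>. Both systems are orthonormal, so if
  \<open>E \<xi>\<close> and \<open>W \<xi>\<close> denote the combinations of the exponentials and of the rearranged Walsh functions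
  with coefficients \<open>\<xi>\<close>, then \<open>\<langle>E \<xi>, E \<eta>\<rangle> = \<langle>W \<xi>, W \<eta>\<rangle>\<close>. An estimate between \<open>E \<eta>\<close> and
  \<open>W \<eta>\<close> in \<open>L\<^sub>p\<close> thus dualises to one between \<open>W \<xi>\<close> and \<open>E \<xi>\<close> in \<open>L\<^sub>q\<close>, provided that the norms
  in \<open>L\<^sub>q\<close> can be computed by testing against functions from the right class. The test function
  that computes the norm of \<open>f\<close> is \<open>\<bar>f\<bar>\<^bsup>q-2\<^esup> f\<close>, and it only has to be approximated uniformly
  (\<open>Lp_norm_le_by_duality\<close>).

  For \<open>f = W \<xi>\<close> the test function is itself a Walsh polynomial almost everywhere: Walsh polynomials
  form an algebra and take finitely many values, so by interpolation any function of a Walsh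
  polynomial is a Walsh polynomial (\<open>walsh_polynomial_compose\<close>). As \<open>\<sigma>\<close> is onto, it is
  of the form \<open>W \<eta>\<close>, which settles one of the two inequalities.

  For \<open>f = E \<xi>\<close> the test function is approximated by trigonometric polynomials, which also contain
  negative frequencies, whereas only the non-negative ones correspond to Walsh functions. The
  negative frequencies do not change the pairing with \<open>f\<close>, but discarding them must not increase the
  norm by more than a constant factor. This is the theorem of M. Riesz that the projection onto the
  non-negative frequencies is bounded (\<open>Riesz_projection_bounded\<close>). It is proved for \<open>p \<le> 2\<close> by
  applying the mean value property to \<open>F\<^sup>p\<close> for an analytic polynomial \<open>F\<close> with positive
  real part, and for the other exponents by duality.
\<close>

section \<open>Bounded functions on the unit interval and duality of norms\<close>

definition conjugate_exponents :: "real \<Rightarrow> real \<Rightarrow> bool" where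
  "conjugate_exponents p q \<longleftrightarrow> 1 < p \<and> 1 < q \<and> 1 / p + 1 / q = 1"

lemma conjugate_exponents_commute: "conjugate_exponents p q \<Longrightarrow> conjugate_exponents q p"
  by (auto simp: conjugate_exponents_def)

lemma conjugate_exponents_mult:
  assumes "conjugate_exponents p q"
  shows "(p - 1) * q = p"
  using assms by (auto simp: conjugate_exponents_def field_simps)

text \<open>
  All functions that occur are bounded, and boundedness makes every integral below converge. The
  bound is demanded on the whole line because that is what holds for functions of period 1.
\<close>

definition bounded_measurable :: "(real \<Rightarrow> complex) \<Rightarrow> bool" where
  "bounded_measurable f \<longleftrightarrow>
     f \<in> borel_measurable (lebesgue_on {0..1}) \<and> (\<exists>B. \<forall>t. norm (f t) \<le> B)"

interpretation unit_interval: finite_measure "lebesgue_on {0..1::real}"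
  by (rule finite_measureI) (simp add: emeasure_restrict_space)

lemma bounded_measurable_bound:
  assumes "bounded_measurable f"
  obtains B where "B > 0" "\<And>t. norm (f t) \<le> B"
proof -
  obtain B where "\<forall>t. norm (f t) \<le> B"
    using assms by (auto simp: bounded_measurable_def)
  then show thesis
    by (intro that[of "max B 1"]) (auto simp: le_max_iff_disj)
qed

lemma bounded_measurable_measurable [measurable_dest]:
  "bounded_measurable f \<Longrightarrow> f \<in> borel_measurable (lebesgue_on {0..1})"
  by (simp add: bounded_measurable_def)

lemma bounded_measurable_const: "bounded_measurable (\<lambda>t. c)"
  by (auto simp: bounded_measurable_def)

lemma bounded_measurable_add:
  assumes "bounded_measurable f" "bounded_measurable g"
  shows "bounded_measurable (\<lambda>t. f t + g t)"
proof -
  obtain A where "\<And>t. norm (f t) \<le> A" using bounded_measurable_bound[OF assms(1)] by blast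
  moreover obtain B where "\<And>t. norm (g t) \<le> B" using bounded_measurable_bound[OF assms(2)] by blast
  ultimately have "norm (f t + g t) \<le> A + B" for t
    by (meson add_mono norm_triangle_ineq order_trans)
  then show ?thesis
    using assms by (auto simp: bounded_measurable_def)
qed

lemma bounded_measurable_mult:
  assumes "bounded_measurable f" "bounded_measurable g"
  shows "bounded_measurable (\<lambda>t. f t * g t)"
proof -
  obtain A where A: "A > 0" "\<And>t. norm (f t) \<le> A" using bounded_measurable_bound[OF assms(1)] by blast
  moreover obtain B where "\<And>t. norm (g t) \<le> B" using bounded_measurable_bound[OF assms(2)] by blast
  ultimately have "norm (f t * g t) \<le> A * B" for t
    by (simp add: norm_mult mult_mono less_imp_le)
  then show ?thesis
    using assms by (auto simp: bounded_measurable_def)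
qed

lemma bounded_measurable_cnj:
  assumes "bounded_measurable f"
  shows "bounded_measurable (\<lambda>t. cnj (f t))"
proof -
  have "cnj \<in> borel_measurable borel"
    by (intro borel_measurable_continuous_onI continuous_intros)
  from measurable_compose[OF bounded_measurable_measurable[OF assms] this]
  show ?thesis
    using assms by (auto simp: bounded_measurable_def)
qed

lemma bounded_measurable_sum:
  assumes "\<And>k. k \<in> A \<Longrightarrow> bounded_measurable (f k)"
  shows "bounded_measurable (\<lambda>t. \<Sum>k\<in>A. f k t)"
  using assms
  by (induction A rule: infinite_finite_induct)
     (auto intro: bounded_measurable_const bounded_measurable_add)

lemmas bounded_measurable_intros =
  bounded_measurable_const bounded_measurable_add bounded_measurable_mult
  bounded_measurable_cnj bounded_measurable_sum

lemma integrable_bounded_measurable: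
  assumes "bounded_measurable f"
  shows "integrable (lebesgue_on {0..1}) f"
  using assms unit_interval.integrable_const_bound[of f]
  by (auto simp: bounded_measurable_def)

lemma integrable_bounded_measurable_powr:
  assumes "bounded_measurable f" "p \<ge> 0"
  shows "integrable (lebesgue_on {0..1}) (\<lambda>t. norm (f t) powr p)"
proof -
  obtain B where B: "\<And>t. norm (f t) \<le> B" using bounded_measurable_bound[OF assms(1)] by blast
  have [measurable]: "f \<in> borel_measurable (lebesgue_on {0..1})"
    using assms(1) by (simp add: bounded_measurable_def)
  show ?thesis
    using B assms(2)
    by (intro unit_interval.integrable_const_bound[of _ "B powr p"]) (auto intro!: powr_mono2)
qed

lemma bounded_measurable_in_Lp:
  "bounded_measurable f \<Longrightarrow> p \<ge> 0 \<Longrightarrow> in_Lp p f"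
  by (simp add: in_Lp_def bounded_measurable_measurable integrable_bounded_measurable_powr)

lemma Lp_norm_nonneg: "Lp_norm p f \<ge> 0"
  by (simp add: Lp_norm_def)

lemma Lp_norm_powr:
  assumes "p > 0"
  shows "Lp_norm p f powr p = (\<integral>t. norm (f t) powr p \<partial>lebesgue_on {0..1})"
proof -
  have "0 \<le> (\<integral>t. norm (f t) powr p \<partial>lebesgue_on {0..1})"
    by (rule Bochner_Integration.integral_nonneg) auto
  then show ?thesis
    using assms by (simp add: Lp_norm_def powr_powr)
qed

lemma Lp_norm_leI:
  assumes "p > 0" "C \<ge> 0"
    and "(\<integral>t. norm (f t) powr p \<partial>lebesgue_on {0..1}) \<le> C powr p"
  shows "Lp_norm p f \<le> C"
  using assms by (metis Lp_norm_powr Lp_norm_nonneg linorder_not_le powr_less_mono2)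

text \<open>
  Young's inequality is applied to the functions divided by numbers slightly above their norms, so
  that norms equal to 0 need no separate treatment.
\<close>

lemma Hoelder_inequality:
  assumes pq: "conjugate_exponents p q"
    and f: "bounded_measurable f" and g: "bounded_measurable g"
  shows "norm (\<integral>t. f t * g t \<partial>lebesgue_on {0..1}) \<le> Lp_norm p f * Lp_norm q g"
proof -
  have p: "p > 1" "q > 1" "1/p + 1/q = 1" using pq by (auto simp: conjugate_exponents_def)
  let ?M = "lebesgue_on {0..1::real}"
  have le: "norm (\<integral>t. f t * g t \<partial>?M) \<le> (Lp_norm p f + d) * (Lp_norm q g + d)" if "d > 0" for d
  proof -
    define x y where "x = Lp_norm p f + d" and "y = Lp_norm q g + d"
    have xy: "x > 0" "y > 0" using that Lp_norm_nonneg[of p f] Lp_norm_nonneg[of q g]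
      by (auto simp: x_def y_def)
    have X: "(\<integral>t. norm (f t) powr p \<partial>?M) \<le> x powr p"
      using that p Lp_norm_nonneg[of p f]
      by (subst Lp_norm_powr[symmetric]) (auto simp: x_def intro!: powr_mono2)
    have Y: "(\<integral>t. norm (g t) powr q \<partial>?M) \<le> y powr q"
      using that p Lp_norm_nonneg[of q g]
      by (subst Lp_norm_powr[symmetric]) (auto simp: y_def intro!: powr_mono2)
    note int = integrable_bounded_measurable_powr[OF f, of p] integrable_bounded_measurable_powr[OF g, of q]
    have "norm (\<integral>t. f t * g t \<partial>?M) \<le> (\<integral>t. norm (f t * g t) \<partial>?M)"
      by (rule integral_norm_bound)
    also have "\<dots> \<le> (\<integral>t. x * y * (norm (f t) powr p / (x powr p * p) + norm (g t) powr q / (y powr q * q)) \<partial>?M)"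
    proof (rule integral_mono)
      show "integrable ?M (\<lambda>t. norm (f t * g t))"
        by (intro integrable_norm integrable_bounded_measurable bounded_measurable_mult f g)
      show "integrable ?M (\<lambda>t. x * y * (norm (f t) powr p / (x powr p * p) + norm (g t) powr q / (y powr q * q)))"
        using int p by auto
      fix t
      have "norm (f t) / x * (norm (g t) / y) \<le> (norm (f t) / x) powr p / p + (norm (g t) / y) powr q / q"
        using p xy by (intro Youngs_inequality) auto
      then have "x * y * (norm (f t) / x * (norm (g t) / y))
          \<le> x * y * ((norm (f t) / x) powr p / p + (norm (g t) / y) powr q / q)"
        using xy by (intro mult_left_mono) auto
      then show "norm (f t * g t) \<le> x * y * (norm (f t) powr p / (x powr p * p) + norm (g t) powr q / (y powr q * q))"
        using xy by (simp add: norm_mult powr_divide)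
    qed
    also have "\<dots> = x * y * ((\<integral>t. norm (f t) powr p \<partial>?M) / (x powr p * p) + (\<integral>t. norm (g t) powr q \<partial>?M) / (y powr q * q))"
      using int p by simp
    also have "\<dots> \<le> x * y * (x powr p / (x powr p * p) + y powr q / (y powr q * q))"
      using X Y xy p by (intro mult_left_mono add_mono divide_right_mono) auto
    also have "\<dots> = x * y"
      using xy p by simp
    finally show ?thesis by (simp add: x_def y_def)
  qed
  have "((\<lambda>d. (Lp_norm p f + d) * (Lp_norm q g + d)) \<longlongrightarrow> (Lp_norm p f + 0) * (Lp_norm q g + 0)) (at_right 0)"
    by (intro tendsto_intros)
  then have "norm (\<integral>t. f t * g t \<partial>?M) \<le> (Lp_norm p f + 0) * (Lp_norm q g + 0)"
    by (rule tendsto_lowerbound) (auto simp: eventually_at_right_less intro!: eventually_at_rightI[of 0 1] le)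
  then show ?thesis by simp
qed

text \<open>
  A substitute for Minkowski's inequality: constants are irrelevant for equivalence.
\<close>

lemma powr_add_le:
  assumes "a \<ge> 0" "b \<ge> 0" "p \<ge> (0::real)"
  shows "(a + b) powr p \<le> 2 powr p * (a powr p + b powr p)"
proof -
  have "(a + b) powr p \<le> (2 * max a b) powr p"
    using assms by (intro powr_mono2) auto
  also have "\<dots> = 2 powr p * (max a b) powr p"
    using assms by (simp add: powr_mult)
  also have "\<dots> \<le> 2 powr p * (a powr p + b powr p)"
    by (intro mult_left_mono) (auto simp: max_def)
  finally show ?thesis .
qed

text \<open>
  Composing \<open>f\<close> with this map gives the function at which \<open>f\<close>, as a functional on \<open>L\<^sub>q\<close>, attains its
  norm, up to a scalar factor.
\<close>

definition duality_map :: "real \<Rightarrow> complex \<Rightarrow> complex" where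
  "duality_map p w = of_real (norm w powr (p - 2)) * w"

lemma norm_duality_map: "norm (duality_map p w) = norm w powr (p - 1)"
proof (cases "w = 0")
  case False
  then show ?thesis
    using powr_add[of "norm w" "p - 2" 1] by (simp add: duality_map_def norm_mult)
qed (simp add: duality_map_def)

lemma mult_cnj_duality_map: "w * cnj (duality_map p w) = of_real (norm w powr p)"
proof (cases "w = 0")
  case False
  have "w * cnj (duality_map p w) = of_real (norm w powr (p - 2)) * (w * cnj w)"
    by (simp add: duality_map_def)
  also have "\<dots> = of_real (norm w powr (p - 2) * (norm w)\<^sup>2)"
    by (simp add: complex_norm_square[symmetric])
  also have "norm w powr (p - 2) * (norm w)\<^sup>2 = norm w powr p"
    using False powr_add[of "norm w" "p - 2" 2] by simp
  finally show ?thesis .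
qed (simp add: duality_map_def)

lemma continuous_on_duality_map:
  assumes "p > 1"
  shows "continuous_on S (duality_map p)"
proof -
  have "isCont (duality_map p) w" for w
  proof (cases "w = 0")
    case False
    then show ?thesis
      unfolding duality_map_def by (intro continuous_intros) auto
  next
    case True
    have "((\<lambda>v :: complex. norm v powr (p - 1)) \<longlongrightarrow> 0 powr (p - 1)) (at 0)"
      using assms by (intro tendsto_powr2 tendsto_norm_zero tendsto_intros) auto
    then have "(duality_map p \<longlongrightarrow> 0) (at 0)"
      by (subst tendsto_norm_zero_iff[symmetric]) (simp add: norm_duality_map)
    then show ?thesis using True by (simp add: isCont_def duality_map_def)
  qed
  then show ?thesis by (simp add: continuous_at_imp_continuous_on)
qed

text \<open>
  Write \<open>X\<close> for the integral of \<open>\<bar>f\<bar>\<^sup>p\<close>. If \<open>g\<close> were equal to the test function, then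
  \<open>X = \<langle>f, g\<rangle> \<le> M X\<^bsup>1/q\<^esup>\<close>, hence \<open>\<parallel>f\<parallel>\<^sub>p = X\<^bsup>1/p\<^esup> \<le> M\<close>. An approximation with small enough
  error costs a constant factor. Approximations have to be allowed because the test function of a
  trigonometric polynomial need not be one.
\<close>

lemma Lp_norm_le_by_duality:
  assumes pq: "conjugate_exponents p q" and f: "bounded_measurable f" and M: "M \<ge> 0"
    and approx: "\<And>e. e > 0 \<Longrightarrow> \<exists>g. bounded_measurable g \<and>
           (AE t in lebesgue_on {0..1}. norm (g t - duality_map p (f t)) \<le> e) \<and>
           norm (\<integral>t. f t * cnj (g t) \<partial>lebesgue_on {0..1}) \<le> M * Lp_norm q g"
  shows "Lp_norm p f \<le> 8 * M"
proof -
  let ?M = "lebesgue_on {0..1::real}"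
  have p: "p > 1" "q > 1" "1/p + 1/q = 1" using pq by (auto simp: conjugate_exponents_def)
  obtain B where B: "B > 0" "\<And>t. norm (f t) \<le> B" using bounded_measurable_bound[OF f] by blast
  define X where "X = (\<integral>t. norm (f t) powr p \<partial>?M)"
  have X0: "X \<ge> 0" unfolding X_def by (rule Bochner_Integration.integral_nonneg) auto
  show ?thesis
  proof (cases "X = 0")
    case True
    then show ?thesis using M by (simp add: Lp_norm_def X_def[symmetric])
  next
    case False
    with X0 have X: "X > 0" by simp
    \<comment> \<open>The first bound keeps the error in the pairing at most \<open>X / 2\<close>, the second one keeps
      the error in the norm of the test function comparable with that norm.\<close>
    define e where "e = min (X / (2 * B)) (X powr (1 / q))"
    have e: "e > 0" "e * B \<le> X / 2" "e powr q \<le> X"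
    proof -
      show "e > 0" using X B by (auto simp: e_def)
      have "e \<le> X / (2 * B)" by (simp add: e_def)
      then show "e * B \<le> X / 2" using B by (simp add: field_simps)
      have "e powr q \<le> (X powr (1/q)) powr q"
        using \<open>e > 0\<close> p by (intro powr_mono2) (auto simp: e_def)
      then show "e powr q \<le> X" using X p by (simp add: powr_powr)
    qed
    obtain g where g: "bounded_measurable g"
      and ge: "AE t in ?M. norm (g t - duality_map p (f t)) \<le> e"
      and gM: "norm (\<integral>t. f t * cnj (g t) \<partial>?M) \<le> M * Lp_norm q g"
      using approx[OF \<open>e > 0\<close>] by blast
    note [measurable] = bounded_measurable_measurable[OF f] bounded_measurable_measurable[OF g]
    note int = integrable_bounded_measurable_powr[OF f, of p]
    have ifg: "integrable ?M (\<lambda>t. f t * cnj (g t))"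
      by (intro integrable_bounded_measurable bounded_measurable_intros f g)
    have "X = norm (\<integral>t. complex_of_real (norm (f t) powr p) \<partial>?M)"
      using X by (simp add: X_def)
    also have "\<dots> = norm ((\<integral>t. f t * cnj (g t) \<partial>?M)
       + (\<integral>t. complex_of_real (norm (f t) powr p) - f t * cnj (g t) \<partial>?M))"
      using int p ifg by simp
    also have "\<dots> \<le> M * Lp_norm q g + B * e"
    proof -
      have "norm (\<integral>t. complex_of_real (norm (f t) powr p) - f t * cnj (g t) \<partial>?M)
          \<le> (\<integral>t. B * e \<partial>?M)"
      proof (rule order_trans[OF integral_norm_bound integral_mono_AE])
        show "integrable ?M (\<lambda>t. norm (complex_of_real (norm (f t) powr p) - f t * cnj (g t)))"
          using int p ifg by auto
        show "AE t in ?M. norm (complex_of_real (norm (f t) powr p) - f t * cnj (g t)) \<le> B * e"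
          using ge
        proof eventually_elim
          case (elim t)
          have "complex_of_real (norm (f t) powr p) - f t * cnj (g t)
              = - (f t * cnj (g t - duality_map p (f t)))"
            by (simp only: complex_cnj_diff right_diff_distrib mult_cnj_duality_map) simp
          then have "norm (complex_of_real (norm (f t) powr p) - f t * cnj (g t))
              = norm (f t) * norm (g t - duality_map p (f t))"
            by (simp only: norm_minus_cancel norm_mult complex_mod_cnj)
          also have "\<dots> \<le> B * e"
            using B elim by (intro mult_mono) auto
          finally show ?case .
        qed
      qed auto
      then show ?thesis
        using gM by (intro order_trans[OF norm_triangle_ineq] add_mono) (auto simp: measure_restrict_space)
    qed
    finally have "X / 2 \<le> M * Lp_norm q g" using e by (simp add: mult.commute)
    also have "\<dots> \<le> M * (4 * X powr (1/q))"
    proof (rule mult_left_mono[OF Lp_norm_leI M])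
      have "(\<integral>t. norm (g t) powr q \<partial>?M) \<le> (\<integral>t. 2 powr q * (norm (f t) powr p + e powr q) \<partial>?M)"
      proof (rule integral_mono_AE)
        show "integrable ?M (\<lambda>t. norm (g t) powr q)"
          using p by (intro integrable_bounded_measurable_powr g) auto
        show "integrable ?M (\<lambda>t. 2 powr q * (norm (f t) powr p + e powr q))"
          using int p by auto
        show "AE t in ?M. norm (g t) powr q \<le> 2 powr q * (norm (f t) powr p + e powr q)"
          using ge
        proof eventually_elim
          case (elim t)
          have "norm (g t) = norm (duality_map p (f t)
              + (g t - duality_map p (f t)))" by simp
          also have "\<dots> \<le> norm (f t) powr (p - 1) + e"
            by (intro norm_triangle_le add_mono) (use elim in \<open>auto simp: norm_duality_map\<close>)
          finally have "norm (g t) powr q \<le> (norm (f t) powr (p - 1) + e) powr q"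
            using p by (intro powr_mono2) auto
          also have "\<dots> \<le> 2 powr q * ((norm (f t) powr (p - 1)) powr q + e powr q)"
            using p e by (intro powr_add_le) auto
          finally show ?case
            by (simp add: powr_powr conjugate_exponents_mult[OF pq])
        qed
      qed
      also have "\<dots> = 2 powr q * (X + e powr q)"
        using int p by (simp add: X_def measure_restrict_space)
      also have "\<dots> \<le> 2 powr q * (2 powr q * X)"
      proof (rule mult_left_mono)
        have "(2::real) powr 1 \<le> 2 powr q" using p by (intro powr_mono) auto
        then have "2 * X \<le> 2 powr q * X" using X by (intro mult_right_mono) auto
        then show "X + e powr q \<le> 2 powr q * X" using e by simp
      qed auto
      also have "\<dots> = (4 * X powr (1/q)) powr q"
        using p X by (simp add: powr_mult powr_powr powr_mult[symmetric] del: powr_numeral)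
      finally show "(\<integral>t. norm (g t) powr q \<partial>?M) \<le> (4 * X powr (1/q)) powr q" .
    qed (use p in auto)
    finally have "X \<le> 8 * M * X powr (1/q)" by simp
    moreover have "X = X powr (1/p) * X powr (1/q)"
      using X p by (simp add: powr_add[symmetric])
    ultimately have "X powr (1/p) * X powr (1/q) \<le> 8 * M * X powr (1/q)" by simp
    then have "X powr (1/p) \<le> 8 * M" using X by simp
    then show ?thesis using M by (simp add: Lp_norm_def X_def)
  qed
qed

section \<open>Trigonometric polynomials on the unit circle\<close>

definition circle_point :: "real \<Rightarrow> complex" where
  "circle_point t = exp (2 * of_real pi * \<i> * of_real t)"

lemma norm_circle_point [simp]: "norm (circle_point t) = 1"
  by (simp add: circle_point_def norm_exp_eq_Re)

lemma trig_eq_power: "trig k t = circle_point t ^ k"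
  by (simp add: trig_def circle_point_def exp_of_nat_mult[symmetric] mult_ac)

lemma bounded_measurable_circle:
  assumes "continuous_on (sphere 0 1) h"
  shows "bounded_measurable (\<lambda>t. h (circle_point t))"
proof -
  have "continuous_on {0..1} (\<lambda>t. h (circle_point t))"
    by (rule continuous_on_compose2[OF assms])
       (auto simp: circle_point_def norm_exp_eq_Re intro!: continuous_intros)
  then have "(\<lambda>t. h (circle_point t)) \<in> borel_measurable (lebesgue_on {0..1})"
    by (intro continuous_imp_measurable_on_sets_lebesgue) auto
  moreover have "bounded (h ` sphere 0 1)"
    by (intro compact_imp_bounded compact_continuous_image assms) simp
  then obtain B where "\<And>z. norm z = 1 \<Longrightarrow> norm (h z) \<le> B"
    by (fastforce simp: bounded_iff)
  then have "\<forall>t. norm (h (circle_point t)) \<le> B" by simp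
  ultimately show ?thesis
    by (auto simp: bounded_measurable_def)
qed

lemma bounded_measurable_poly: "bounded_measurable (\<lambda>t. poly f (circle_point t))"
  by (rule bounded_measurable_circle) (intro continuous_intros)

text \<open>
  Cauchy's integral formula at the centre of the disc.
\<close>

lemma integral_circle_mean_value:
  assumes "continuous_on (cball 0 1) G" "G holomorphic_on ball 0 1"
  shows "(\<integral>t. G (circle_point t) \<partial>lebesgue_on {0..1}) = G 0"
proof -
  have "((\<lambda>u. G u / (u - 0)) has_contour_integral (2 * of_real pi * \<i> * G 0)) (circlepath 0 1)"
    using assms by (intro Cauchy_integral_circlepath) auto
  then have "((\<lambda>t. G (circle_point t) / circle_point t * (2 * of_real pi * \<i> * circle_point t))
       has_integral (2 * of_real pi * \<i> * G 0)) {0..1}"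
    by (simp add: has_contour_integral vector_derivative_circlepath)
       (simp add: circlepath circle_point_def)
  then have "((\<lambda>t. (2 * of_real pi * \<i>) * G (circle_point t)) has_integral (2 * of_real pi * \<i> * G 0)) {0..1}"
    by (simp add: mult_ac) (simp add: circle_point_def)
  moreover have cancel: "inverse (2 * of_real pi * \<i>) * ((2 * of_real pi * \<i>) * w) = w" for w
    by (subst mult.assoc[symmetric], subst left_inverse) auto
  ultimately have "((\<lambda>t. G (circle_point t)) has_integral G 0) {0..1}"
    using has_integral_mult_right[of "\<lambda>t. (2 * of_real pi * \<i>) * G (circle_point t)"
      "(2 * of_real pi * \<i>) * G 0" "{0..1}" "inverse (2 * of_real pi * \<i>)"]
    by (simp only: cancel)
  moreover have "integrable (lebesgue_on {0..1}) (\<lambda>t. G (circle_point t))"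
    by (intro integrable_bounded_measurable bounded_measurable_circle continuous_on_subset[OF assms(1)]) auto
  ultimately show ?thesis
    by (simp add: lebesgue_integral_eq_integral integral_unique)
qed

lemma integral_poly_circle: "(\<integral>t. poly f (circle_point t) \<partial>lebesgue_on {0..1}) = poly f 0"
  by (rule integral_circle_mean_value) (intro continuous_intros holomorphic_intros)+

text \<open>
  Splitting into an analytic and an anti-analytic part puts the non-negative frequencies into \<open>f\<close>,
  which is the form in which the Riesz projection acts. Only the values on the circle matter.
\<close>

definition trig_polynomial :: "(complex \<Rightarrow> complex) \<Rightarrow> bool" where
  "trig_polynomial h \<longleftrightarrow> (\<exists>f g. \<forall>z. norm z = 1 \<longrightarrow> h z = poly f z + cnj (poly g z))"

lemma trig_polynomial_poly: "trig_polynomial (poly f)"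
  unfolding trig_polynomial_def by (rule exI[of _ f], rule exI[of _ 0]) simp

lemma trig_polynomial_cnj:
  assumes "trig_polynomial h"
  shows "trig_polynomial (\<lambda>z. cnj (h z))"
proof -
  obtain f g where "\<And>z. norm z = 1 \<Longrightarrow> h z = poly f z + cnj (poly g z)"
    using assms by (auto simp: trig_polynomial_def)
  then show ?thesis
    unfolding trig_polynomial_def by (intro exI[of _ g] exI[of _ f]) auto
qed

lemma trig_polynomial_add:
  assumes "trig_polynomial h" "trig_polynomial k"
  shows "trig_polynomial (\<lambda>z. h z + k z)"
proof -
  obtain f g where "\<And>z. norm z = 1 \<Longrightarrow> h z = poly f z + cnj (poly g z)"
    using assms by (auto simp: trig_polynomial_def)
  moreover obtain f' g' where "\<And>z. norm z = 1 \<Longrightarrow> k z = poly f' z + cnj (poly g' z)"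
    using assms by (auto simp: trig_polynomial_def)
  ultimately show ?thesis
    unfolding trig_polynomial_def by (intro exI[of _ "f + f'"] exI[of _ "g + g'"]) auto
qed

lemma trig_polynomial_cmult:
  assumes "trig_polynomial h"
  shows "trig_polynomial (\<lambda>z. c * h z)"
proof -
  obtain f g where "\<And>z. norm z = 1 \<Longrightarrow> h z = poly f z + cnj (poly g z)"
    using assms by (auto simp: trig_polynomial_def)
  then show ?thesis
    unfolding trig_polynomial_def
    by (intro exI[of _ "smult c f"] exI[of _ "smult (cnj c) g"]) (auto simp: algebra_simps)
qed

text \<open>
  On the circle \<open>z\<close> is inverse to \<open>cnj z\<close>; so multiplication by \<open>z\<close> lowers the degree of the
  anti-analytic part, whose constant coefficient moves to the analytic part.
\<close>

lemma trig_polynomial_mult_id: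
  assumes "trig_polynomial h"
  shows "trig_polynomial (\<lambda>z. z * h z)"
proof -
  obtain f g where h: "\<And>z. norm z = 1 \<Longrightarrow> h z = poly f z + cnj (poly g z)"
    using assms by (auto simp: trig_polynomial_def)
  obtain a g' where g: "g = pCons a g'" by (cases g)
  have "z * h z = poly (pCons (cnj a) 0 * [:0, 1:] + pCons 0 f) z + cnj (poly g' z)" if "norm z = 1" for z
  proof -
    have "z * cnj z = 1" using that by (simp add: complex_norm_square[symmetric])
    then have "z * cnj (z * poly g' z) = cnj (poly g' z)" by (simp add: mult.assoc[symmetric])
    then show ?thesis by (simp add: h[OF that] g algebra_simps)
  qed
  then show ?thesis unfolding trig_polynomial_def by blast
qed

lemma trig_polynomial_poly_mult:
  assumes "trig_polynomial h"
  shows "trig_polynomial (\<lambda>z. poly f z * h z)"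
proof (induction f)
  case 0
  then show ?case using trig_polynomial_poly[of 0] by (simp add: fun_eq_iff trig_polynomial_def)
next
  case (pCons a f)
  have "trig_polynomial (\<lambda>z. a * h z + z * (poly f z * h z))"
    by (intro trig_polynomial_add trig_polynomial_cmult trig_polynomial_mult_id assms pCons)
  then show ?case by (simp add: algebra_simps)
qed

lemma trig_polynomial_mult:
  assumes "trig_polynomial h" "trig_polynomial k"
  shows "trig_polynomial (\<lambda>z. h z * k z)"
proof -
  obtain f g where h: "\<And>z. norm z = 1 \<Longrightarrow> h z = poly f z + cnj (poly g z)"
    using assms by (auto simp: trig_polynomial_def)
  have "trig_polynomial (\<lambda>z. poly f z * k z + cnj (poly g z * cnj (k z)))"
    by (intro trig_polynomial_add trig_polynomial_poly_mult trig_polynomial_cnj assms)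
  then show ?thesis
    by (auto simp: trig_polynomial_def h algebra_simps)
qed

text \<open>
  This transfers the Stone--Weierstrass theorem, which concerns polynomials in the real coordinates,
  to trigonometric polynomials.
\<close>

lemma trig_polynomial_real_polynomial_function:
  fixes u :: "complex \<Rightarrow> real"
  assumes "real_polynomial_function u"
  shows "trig_polynomial (\<lambda>z. of_real (u z))"
  using assms
proof induction
  case (linear f)
  have eq: "complex_of_real (f z) = of_real (f 1) / 2 * (z + cnj z) + of_real (f \<i>) / 2 * (- \<i> * z + cnj (- \<i> * z))" for z
  proof -
    have "f z = f (Re z *\<^sub>R 1 + Im z *\<^sub>R \<i>)"
      by (intro arg_cong[of _ _ f]) (simp add: complex_eq_iff)
    also have "\<dots> = Re z * f 1 + Im z * f \<i>"
      using linear by (simp add: bounded_linear.linear linear_add linear_scale del: scaleR_one)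
    finally have "f z = Re z * f 1 + Im z * f \<i>" .
    then show ?thesis by (simp add: complex_eq_iff field_simps)
  qed
  have id: "trig_polynomial (\<lambda>z. z)" using trig_polynomial_poly[of "[:0, 1:]"]
    by (simp add: trig_polynomial_def)
  have "trig_polynomial (\<lambda>z. of_real (f 1) / 2 * (z + cnj z) + of_real (f \<i>) / 2 * (- \<i> * z + cnj (- \<i> * z)))"
    by (intro trig_polynomial_add trig_polynomial_cmult trig_polynomial_cnj id)
  then show ?case by (simp only: eq[symmetric])
next
  case (const c)
  then show ?case using trig_polynomial_poly[of "[:of_real c:]"]
    by (simp add: trig_polynomial_def)
qed (simp_all add: trig_polynomial_add trig_polynomial_mult)

text \<open>
  A real trigonometric polynomial \<open>f + cnj g\<close> has the same real part as the analytic polynomial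
  \<open>f + g\<close>, from which an imaginary constant may be subtracted.
\<close>

lemma continuous_approx_Re_poly:
  fixes u :: "complex \<Rightarrow> real"
  assumes "continuous_on (sphere 0 1) u" "e > 0"
  obtains U where "Im (poly U 0) = 0" "\<And>z. norm z = 1 \<Longrightarrow> \<bar>u z - Re (poly U z)\<bar> < e"
proof -
  obtain r where r: "real_polynomial_function r" and ur: "\<And>z. z \<in> sphere 0 1 \<Longrightarrow> \<bar>u z - r z\<bar> < e"
    using Stone_Weierstrass_real_polynomial_function[OF _ assms] compact_sphere by blast
  obtain f g where fg: "\<And>z. norm z = 1 \<Longrightarrow> of_real (r z) = poly f z + cnj (poly g z)"
    using trig_polynomial_real_polynomial_function[OF r] by (auto simp: trig_polynomial_def)
  define U where "U = f + g - [:\<i> * of_real (Im (poly (f + g) 0)):]"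
  show thesis
  proof
    show "Im (poly U 0) = 0" by (simp add: U_def)
    fix z :: complex assume z: "norm z = 1"
    have "r z = Re (poly U z)"
      using arg_cong[OF fg[OF z], of Re] by (simp add: U_def)
    then show "\<bar>u z - Re (poly U z)\<bar> < e" using ur[of z] z by simp
  qed
qed

lemma continuous_approx_trig_polynomial:
  assumes "continuous_on (sphere 0 1) \<phi>" "e > 0"
  obtains f g where "poly g 0 = 0"
    "\<And>z. norm z = 1 \<Longrightarrow> norm (poly f z + cnj (poly g z) - \<phi> z) \<le> e"
proof -
  have "continuous_on (sphere 0 1) (\<lambda>z. Re (\<phi> z))" "continuous_on (sphere 0 1) (\<lambda>z. Im (\<phi> z))"
    using assms by (auto intro!: continuous_intros)
  then obtain U V where U: "\<And>z. norm z = 1 \<Longrightarrow> \<bar>Re (\<phi> z) - Re (poly U z)\<bar> < e / 2"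
    and V: "\<And>z. norm z = 1 \<Longrightarrow> \<bar>Im (\<phi> z) - Re (poly V z)\<bar> < e / 2"
    using continuous_approx_Re_poly[of _ "e/2"] \<open>e > 0\<close> by (metis half_gt_zero)
  \<comment> \<open>\<open>Re U + \<i> Re V = (U + \<i> V) / 2 + cnj ((U - \<i> V) / 2)\<close>; the constant \<open>c\<close> is
    moved from the second part to the first one.\<close>
  define c where "c = (poly U 0 - \<i> * poly V 0) / 2"
  define f where "f = smult (1/2) (U + smult \<i> V) + [:cnj c:]"
  define g where "g = smult (1/2) (U - smult \<i> V) - [:c:]"
  show thesis
  proof
    show "poly g 0 = 0" by (simp add: g_def c_def)
    fix z :: complex assume z: "norm z = 1"
    have "poly f z + cnj (poly g z) = of_real (Re (poly U z)) + \<i> * of_real (Re (poly V z))"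
      by (simp add: f_def g_def complex_eq_iff field_simps)
    then have "norm (poly f z + cnj (poly g z) - \<phi> z)
        \<le> \<bar>Re (poly U z) - Re (\<phi> z)\<bar> + \<bar>Re (poly V z) - Im (\<phi> z)\<bar>"
      using cmod_le[of "poly f z + cnj (poly g z) - \<phi> z"] by simp
    then show "norm (poly f z + cnj (poly g z) - \<phi> z) \<le> e"
      using U[OF z] V[OF z] by linarith
  qed
qed

section \<open>The inequality of M. Riesz for analytic polynomials\<close>

text \<open>
  In polar coordinates the claim is \<open>1 \<le> A cos\<^sup>p a - B cos (p a)\<close> for \<open>\<bar>a\<bar> < \<pi>/2\<close>. As \<open>1 < p \<le> 2\<close>,
  \<open>cos (p a)\<close> is negative and bounded away from 0 when \<open>\<bar>a\<bar>\<close> is close to \<open>\<pi>/2\<close>, so that the second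
  term suffices there; for the other angles \<open>cos a\<close> is bounded away from 0, and the first
  term takes over.
\<close>

lemma Riesz_pointwise_inequality:
  fixes p :: real
  assumes "1 < p" "p \<le> 2"
  obtains A B where "A \<ge> 0" "B \<ge> 0"
    "\<And>z :: complex. Re z > 0 \<Longrightarrow> norm z powr p \<le> A * Re z powr p - B * Re (z powr of_real p)"
proof -
  \<comment> \<open>Any angle with \<open>\<pi>/2 < p \<theta>\<close> and \<open>\<theta> < \<pi>/2\<close> separates the two cases.\<close>
  define \<theta> where "\<theta> = (pi / (2 * p) + pi / 2) / 2"
  have "pi / (2 * p) < pi / 2" using assms by (simp add: field_simps)
  then have th: "pi / (2 * p) < \<theta>" "\<theta> < pi / 2" "\<theta> > 0"
    using assms by (auto simp: \<theta>_def intro!: add_pos_pos)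
  have pth: "pi / 2 < p * \<theta>" "p * \<theta> < pi"
  proof -
    show "pi / 2 < p * \<theta>" using th(1) assms by (simp add: field_simps)
    have "p * \<theta> < p * (pi / 2)" using th(2) assms by simp
    also have "\<dots> \<le> 2 * (pi / 2)" using assms by (intro mult_right_mono) auto
    finally show "p * \<theta> < pi" by simp
  qed
  have c1: "cos (p * \<theta>) < 0"
    using cos_monotone_0_pi[of "pi/2" "p * \<theta>"] pth by simp
  have c2: "cos \<theta> > 0"
    using th by (intro cos_gt_zero_pi) auto
  define B where "B = - 1 / cos (p * \<theta>)"
  define A where "A = (1 + B) / cos \<theta> powr p"
  have B: "B \<ge> 0" using c1 by (simp add: B_def field_simps)
  then have AB: "A \<ge> 0" "B \<ge> 0" using c2 by (auto simp: A_def)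
  show thesis
  proof (rule that[OF AB])
    fix z :: complex assume z: "Re z > 0"
    define a where "a = Arg z"
    have z0: "z \<noteq> 0" using z by auto
    have a: "\<bar>a\<bar> < pi / 2" using Re_Ln_pos_lt[OF z0] z by (simp only: a_def Arg_eq_Im_Ln[OF z0])
    have Rez: "Re z = norm z * cos a"
      by (metis Re_rcis rcis_cmod_Arg a_def)
    have ca: "cos a > 0" using a by (intro cos_gt_zero_pi) auto
    have Rezp: "Re (z powr of_real p) = norm z powr p * cos (p * a)"
      using z0 by (simp add: powr_def Re_exp Ln_of_real Arg_eq_Im_Ln a_def)
    have key: "1 \<le> A * cos a powr p - B * cos (p * a)"
    proof (cases "\<bar>a\<bar> \<ge> \<theta>")
      case True
      have "p * \<bar>a\<bar> \<le> 2 * (pi / 2)" using a assms by (intro mult_mono) auto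
      then have "cos (p * \<bar>a\<bar>) \<le> cos (p * \<theta>)"
        using True assms th by (intro cos_monotone_0_pi_le) (auto intro!: mult_left_mono)
      moreover have "cos (p * \<bar>a\<bar>) = cos (p * a)"
        using assms by (metis abs_mult abs_of_pos cos_abs_real less_trans zero_less_one)
      ultimately have "B * cos (p * a) \<le> B * cos (p * \<theta>)"
        using AB by (intro mult_left_mono) auto
      also have "\<dots> = -1" using c1 by (simp add: B_def)
      finally have "1 \<le> - B * cos (p * a)" by simp
      moreover have "A * cos a powr p \<ge> 0" using AB by simp
      ultimately show ?thesis by linarith
    next
      case False
      have "cos \<theta> \<le> cos \<bar>a\<bar>"
        using False th by (intro cos_monotone_0_pi_le) auto
      then have "cos \<theta> powr p \<le> cos a powr p"
        using c2 assms by (intro powr_mono2) auto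
      then have "A * cos \<theta> powr p \<le> A * cos a powr p"
        using AB by (intro mult_left_mono)
      moreover have "A * cos \<theta> powr p = 1 + B" using c2 by (simp add: A_def)
      moreover have "B * cos (p * a) \<le> B * 1" using AB by (intro mult_left_mono) auto
      ultimately show ?thesis by linarith
    qed
    have "norm z powr p * 1 \<le> norm z powr p * (A * cos a powr p - B * cos (p * a))"
      using key by (intro mult_left_mono) auto
    also have "\<dots> = A * Re z powr p - B * Re (z powr of_real p)"
      using ca by (simp add: Rez Rezp powr_mult algebra_simps)
    finally show "norm z powr p \<le> A * Re z powr p - B * Re (z powr of_real p)" by simp
  qed
qed

text \<open>
  The minimum principle for the harmonic function \<open>Re F\<close>, obtained as the maximum modulus principle
  for \<open>exp (- F)\<close>.
\<close>

lemma Re_poly_pos_on_disc: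
  assumes pos: "\<And>z. norm z = 1 \<Longrightarrow> Re (poly F z) > 0" and z: "norm z \<le> 1"
  shows "Re (poly F z) > 0"
proof -
  have "continuous_on (sphere 0 1) (\<lambda>z. Re (poly F z))"
    by (intro continuous_intros)
  then obtain w where w: "norm w = 1" "\<And>z. norm z = 1 \<Longrightarrow> Re (poly F w) \<le> Re (poly F z)"
    using continuous_attains_inf[of "sphere (0::complex) 1" "\<lambda>z. Re (poly F z)"] by (auto simp: dist_norm)
  have "norm (exp (- poly F z)) \<le> exp (- Re (poly F w))"
  proof (rule maximum_modulus_frontier[where S = "cball 0 1" and f = "\<lambda>z. exp (- poly F z)"])
    show "(\<lambda>z. exp (- poly F z)) holomorphic_on interior (cball 0 1)"
      by (intro holomorphic_intros)
    show "continuous_on (closure (cball 0 1)) (\<lambda>z. exp (- poly F z))"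
      by (intro continuous_intros)
  qed (use w z in auto)
  then have "Re (poly F w) \<le> Re (poly F z)" by simp
  then show ?thesis using pos[OF w(1)] by linarith
qed

text \<open>
  The pointwise inequality is integrated over the circle. By the mean value property the
  integral of \<open>F\<^sup>p\<close> is the number \<open>F(0)\<^sup>p\<close>, which is positive and enters with the factor \<open>- B\<close>.
\<close>

lemma Riesz_positive_real_part:
  fixes p :: real
  assumes "1 < p" "p \<le> 2"
  obtains A where "A \<ge> 0"
    "\<And>F. Im (poly F 0) = 0 \<Longrightarrow> (\<And>z. norm z = 1 \<Longrightarrow> Re (poly F z) > 0) \<Longrightarrow>
       (\<integral>t. norm (poly F (circle_point t)) powr p \<partial>lebesgue_on {0..1})
         \<le> A * (\<integral>t. Re (poly F (circle_point t)) powr p \<partial>lebesgue_on {0..1})"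
proof -
  obtain A B where AB: "A \<ge> 0" "B \<ge> 0"
    and le: "\<And>z :: complex. Re z > 0 \<Longrightarrow> norm z powr p \<le> A * Re z powr p - B * Re (z powr of_real p)"
    using Riesz_pointwise_inequality[OF assms] by blast
  show thesis
  proof (rule that[OF AB(1)])
    fix F assume F0: "Im (poly F 0) = 0" and pos: "\<And>z. norm z = 1 \<Longrightarrow> Re (poly F z) > 0"
    let ?M = "lebesgue_on {0..1::real}"
    have pos': "Re (poly F z) > 0" if "norm z \<le> 1" for z
      using Re_poly_pos_on_disc[of F z] pos that by blast
    have nonpos: "poly F z \<notin> \<real>\<^sub>\<le>\<^sub>0" if "norm z \<le> 1" for z
      using pos'[OF that] by (auto simp: complex_nonpos_Reals_iff)
    define G where "G = (\<lambda>z. poly F z powr of_real p)"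
    have contG: "continuous_on (cball 0 1) G"
      unfolding G_def using nonpos
      by (intro holomorphic_on_imp_continuous_on holomorphic_intros) auto
    have "G holomorphic_on ball 0 1"
      unfolding G_def using nonpos by (intro holomorphic_intros) auto
    note G_mean = integral_circle_mean_value[OF contG this]
    have intG: "integrable ?M (\<lambda>t. G (circle_point t))"
      by (intro integrable_bounded_measurable bounded_measurable_circle continuous_on_subset[OF contG]) auto
    have "poly F 0 = of_real (Re (poly F 0))" using F0 by (simp add: complex_eq_iff)
    then have "G 0 = of_real (Re (poly F 0) powr p)"
      using pos'[of 0] by (metis G_def less_imp_le norm_zero powr_of_real zero_le_one)
    then have G0: "Re (G 0) \<ge> 0" by simp
    have b: "bounded_measurable (\<lambda>t. of_real (Re (poly F (circle_point t))))"
      by (rule bounded_measurable_circle) (intro continuous_intros)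
    have intRe: "integrable ?M (\<lambda>t. Re (poly F (circle_point t)) powr p)"
      using integrable_bounded_measurable_powr[OF b, of p] assms pos by (simp add: less_imp_le)
    have "(\<integral>t. norm (poly F (circle_point t)) powr p \<partial>?M)
      \<le> (\<integral>t. A * Re (poly F (circle_point t)) powr p - B * Re (G (circle_point t)) \<partial>?M)"
      using intG intRe assms
      by (intro integral_mono integrable_bounded_measurable_powr bounded_measurable_poly)
         (auto simp: G_def intro!: le pos)
    also have "\<dots> = A * (\<integral>t. Re (poly F (circle_point t)) powr p \<partial>?M) - B * Re (G 0)"
      using intG intRe by (simp add: G_mean[symmetric])
    also have "\<dots> \<le> A * (\<integral>t. Re (poly F (circle_point t)) powr p \<partial>?M)"
      using G0 AB by simp
    finally show "(\<integral>t. norm (poly F (circle_point t)) powr p \<partial>?M)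
      \<le> A * (\<integral>t. Re (poly F (circle_point t)) powr p \<partial>?M)" .
  qed
qed

text \<open>
  To reduce to a positive real part, \<open>F\<close> is written as \<open>U - (U - F)\<close>, where the real part of \<open>U\<close> lies
  uniformly close to, and above, the positive part of \<open>Re F\<close>. Then \<open>U\<close> and \<open>U - F\<close> both have
  positive real part, dominated by \<open>\<bar>Re F\<bar>\<close> up to a small error. The normalisation \<open>Im F(0) = 0\<close> is
  indispensable: \<open>Re F\<close> determines \<open>F\<close> only up to an imaginary constant.
\<close>

lemma Riesz_conjugate_function:
  fixes p :: real
  assumes "1 < p" "p \<le> 2"
  obtains C where "C \<ge> 0"
    "\<And>F. Im (poly F 0) = 0 \<Longrightarrow>
       (\<integral>t. norm (poly F (circle_point t)) powr p \<partial>lebesgue_on {0..1})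
         \<le> C * (\<integral>t. \<bar>Re (poly F (circle_point t))\<bar> powr p \<partial>lebesgue_on {0..1})"
proof -
  let ?M = "lebesgue_on {0..1::real}"
  obtain A where A: "A \<ge> 0" and le:
    "\<And>F. Im (poly F 0) = 0 \<Longrightarrow> (\<And>z. norm z = 1 \<Longrightarrow> Re (poly F z) > 0) \<Longrightarrow>
       (\<integral>t. norm (poly F (circle_point t)) powr p \<partial>?M)
         \<le> A * (\<integral>t. Re (poly F (circle_point t)) powr p \<partial>?M)"
    using Riesz_positive_real_part[OF assms] by blast
  define C where "C = 2 powr p * (2 * A * 2 powr p)"
  show thesis
  proof (rule that[of C])
    show "C \<ge> 0" using A by (simp add: C_def)
    fix F assume F0: "Im (poly F 0) = 0"
    define J where "J = (\<integral>t. \<bar>Re (poly F (circle_point t))\<bar> powr p \<partial>?M)"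
    note intp = integrable_bounded_measurable_powr[OF bounded_measurable_poly, of p]
    have b: "bounded_measurable (\<lambda>t. of_real (Re (poly F (circle_point t))))"
      by (rule bounded_measurable_circle) (intro continuous_intros)
    have intRe: "integrable ?M (\<lambda>t. \<bar>Re (poly F (circle_point t))\<bar> powr p)"
      using integrable_bounded_measurable_powr[OF b, of p] assms by simp
    have step: "(\<integral>t. norm (poly F (circle_point t)) powr p \<partial>?M) \<le> C * (J + d)" if d: "d > 0" for d
    proof -
      \<comment> \<open>Both real parts will exceed \<open>\<bar>Re F\<bar>\<close> by at most \<open>3 e\<close>; the shift by \<open>2 e\<close>
        below keeps them positive when \<open>U\<close> is only accurate up to \<open>e\<close>.\<close>
      define e where "e = d powr (1/p) / 3"
      have e: "e > 0" "(3 * e) powr p = d" using d assms by (auto simp: e_def powr_powr)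
      have "continuous_on (sphere 0 1) (\<lambda>z. max (Re (poly F z)) 0 + 2 * e)"
        by (intro continuous_intros)
      from continuous_approx_Re_poly[OF this \<open>e > 0\<close>]
      obtain U where U0: "Im (poly U 0) = 0"
        and U: "\<And>z. norm z = 1 \<Longrightarrow> \<bar>max (Re (poly F z)) 0 + 2 * e - Re (poly U z)\<bar> < e" by blast
      have bound: "(\<integral>t. norm (poly V (circle_point t)) powr p \<partial>?M) \<le> A * 2 powr p * (J + d)"
        if V0: "Im (poly V 0) = 0"
          and V: "\<And>z. norm z = 1 \<Longrightarrow> 0 < Re (poly V z) \<and> Re (poly V z) \<le> \<bar>Re (poly F z)\<bar> + 3 * e" for V
      proof -
        have bV: "bounded_measurable (\<lambda>t. of_real (Re (poly V (circle_point t))))"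
          by (rule bounded_measurable_circle) (intro continuous_intros)
        have intV: "integrable ?M (\<lambda>t. Re (poly V (circle_point t)) powr p)"
          using integrable_bounded_measurable_powr[OF bV, of p] assms V by (simp add: less_imp_le)
        have "(\<integral>t. norm (poly V (circle_point t)) powr p \<partial>?M)
          \<le> A * (\<integral>t. Re (poly V (circle_point t)) powr p \<partial>?M)"
          using V by (intro le V0) auto
        also have "\<dots> \<le> A * (\<integral>t. 2 powr p * (\<bar>Re (poly F (circle_point t))\<bar> powr p + d) \<partial>?M)"
        proof (intro mult_left_mono[OF integral_mono] A intV)
          show "integrable ?M (\<lambda>t. 2 powr p * (\<bar>Re (poly F (circle_point t))\<bar> powr p + d))"
            using intRe by auto
          fix t
          have "Re (poly V (circle_point t)) powr p \<le> (\<bar>Re (poly F (circle_point t))\<bar> + 3 * e) powr p"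
            using V[of "circle_point t"] assms by (intro powr_mono2) auto
          also have "\<dots> \<le> 2 powr p * (\<bar>Re (poly F (circle_point t))\<bar> powr p + (3 * e) powr p)"
            using e assms by (intro powr_add_le) auto
          finally show "Re (poly V (circle_point t)) powr p
              \<le> 2 powr p * (\<bar>Re (poly F (circle_point t))\<bar> powr p + d)" using e by simp
        qed
        also have "(\<integral>t. 2 powr p * (\<bar>Re (poly F (circle_point t))\<bar> powr p + d) \<partial>?M) = 2 powr p * (J + d)"
          using intRe by (simp add: J_def measure_restrict_space)
        finally show ?thesis by (simp add: mult_ac)
      qed
      have bU: "(\<integral>t. norm (poly U (circle_point t)) powr p \<partial>?M) \<le> A * 2 powr p * (J + d)"
      proof (rule bound[OF U0])
        fix z :: complex assume z: "norm z = 1"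
        show "0 < Re (poly U z) \<and> Re (poly U z) \<le> \<bar>Re (poly F z)\<bar> + 3 * e"
          using U[OF z] e by (auto simp: max_def abs_if split: if_splits)
      qed
      have bUF: "(\<integral>t. norm (poly (U - F) (circle_point t)) powr p \<partial>?M) \<le> A * 2 powr p * (J + d)"
      proof (rule bound)
        show "Im (poly (U - F) 0) = 0" using U0 F0 by simp
        fix z :: complex assume z: "norm z = 1"
        show "0 < Re (poly (U - F) z) \<and> Re (poly (U - F) z) \<le> \<bar>Re (poly F z)\<bar> + 3 * e"
          using U[OF z] e by (auto simp: max_def abs_if split: if_splits)
      qed
      have "(\<integral>t. norm (poly F (circle_point t)) powr p \<partial>?M)
        \<le> (\<integral>t. 2 powr p * (norm (poly U (circle_point t)) powr p + norm (poly (U - F) (circle_point t)) powr p) \<partial>?M)"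
      proof (rule integral_mono)
        fix t
        have "norm (poly F (circle_point t)) \<le> norm (poly U (circle_point t)) + norm (poly (U - F) (circle_point t))"
          using norm_triangle_ineq4[of "poly U (circle_point t)" "poly (U - F) (circle_point t)"] by simp
        then have "norm (poly F (circle_point t)) powr p
            \<le> (norm (poly U (circle_point t)) + norm (poly (U - F) (circle_point t))) powr p"
          using assms by (intro powr_mono2) auto
        also have "\<dots> \<le> 2 powr p * (norm (poly U (circle_point t)) powr p + norm (poly (U - F) (circle_point t)) powr p)"
          using assms by (intro powr_add_le) auto
        finally show "norm (poly F (circle_point t)) powr p
          \<le> 2 powr p * (norm (poly U (circle_point t)) powr p + norm (poly (U - F) (circle_point t)) powr p)" .
      qed (use intp[of U] intp[of "U - F"] intp[of F] assms in auto)
      also have "\<dots> = 2 powr p * ((\<integral>t. norm (poly U (circle_point t)) powr p \<partial>?M)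
            + (\<integral>t. norm (poly (U - F) (circle_point t)) powr p \<partial>?M))"
        using intp[of U] intp[of "U - F"] assms by (simp del: poly_diff)
      also have "\<dots> \<le> 2 powr p * (A * 2 powr p * (J + d) + A * 2 powr p * (J + d))"
        using bU bUF by (intro mult_left_mono add_mono) auto
      finally show ?thesis by (simp add: C_def algebra_simps)
    qed
    have "((\<lambda>d. C * (J + d)) \<longlongrightarrow> C * (J + 0)) (at_right 0)"
      by (intro tendsto_intros)
    then have "(\<integral>t. norm (poly F (circle_point t)) powr p \<partial>?M) \<le> C * (J + 0)"
      by (rule tendsto_lowerbound) (auto intro!: eventually_at_rightI[of 0 1] step)
    then show "(\<integral>t. norm (poly F (circle_point t)) powr p \<partial>?M)
         \<le> C * (\<integral>t. \<bar>Re (poly F (circle_point t))\<bar> powr p \<partial>?M)"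
      by (simp add: J_def)
  qed
qed

section \<open>The Riesz projection\<close>

text \<open>
  The anti-analytic part \<open>cnj b\<close> of a test function pairs to 0 with \<open>f\<close> because
  \<open>f b\<close> is analytic and vanishes at 0. So the hypothesis involves only the analytic part \<open>a\<close> on its
  left-hand side, while the norm on the right is that of the whole test function.
\<close>

lemma Lp_norm_poly_le_by_duality:
  assumes pq: "conjugate_exponents p q" and M: "M \<ge> 0"
    and le: "\<And>a b. poly b 0 = 0 \<Longrightarrow>
       norm (\<integral>t. poly f (circle_point t) * cnj (poly a (circle_point t)) \<partial>lebesgue_on {0..1})
         \<le> M * Lp_norm q (\<lambda>t. poly a (circle_point t) + cnj (poly b (circle_point t)))"
  shows "Lp_norm p (\<lambda>t. poly f (circle_point t)) \<le> 8 * M"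
proof (rule Lp_norm_le_by_duality[OF pq bounded_measurable_poly M])
  fix e :: real assume e: "e > 0"
  let ?M = "lebesgue_on {0..1::real}"
  have "p > 1" using pq by (simp add: conjugate_exponents_def)
  then have "continuous_on (sphere 0 1) (\<lambda>z. duality_map p (poly f z))"
    by (intro continuous_on_compose2[OF continuous_on_duality_map[of p UNIV]] continuous_intros) auto
  from continuous_approx_trig_polynomial[OF this e] obtain a b where b: "poly b 0 = 0"
    and ab: "\<And>z. norm z = 1 \<Longrightarrow>
       norm (poly a z + cnj (poly b z) - duality_map p (poly f z)) \<le> e"
    by blast
  let ?g = "\<lambda>t. poly a (circle_point t) + cnj (poly b (circle_point t))"
  have "(\<integral>t. poly f (circle_point t) * cnj (?g t) \<partial>?M)
     = (\<integral>t. poly f (circle_point t) * cnj (poly a (circle_point t)) \<partial>?M)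
       + (\<integral>t. poly (f * b) (circle_point t) \<partial>?M)"
    by (subst Bochner_Integration.integral_add[symmetric])
       (auto intro!: integrable_bounded_measurable bounded_measurable_intros bounded_measurable_poly
             simp: algebra_simps)
  also have "(\<integral>t. poly (f * b) (circle_point t) \<partial>?M) = 0"
    unfolding integral_poly_circle using b by simp
  finally have "norm (\<integral>t. poly f (circle_point t) * cnj (?g t) \<partial>?M) \<le> M * Lp_norm q ?g"
    using le[OF b, of a] by simp
  moreover have "bounded_measurable ?g"
    by (intro bounded_measurable_intros bounded_measurable_poly)
  ultimately show "\<exists>g. bounded_measurable g \<and>
     (AE t in ?M. norm (g t - duality_map p (poly f (circle_point t))) \<le> e) \<and>
     norm (\<integral>t. poly f (circle_point t) * cnj (g t) \<partial>?M) \<le> M * Lp_norm q g"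
    using ab by (intro exI[of _ ?g]) auto
qed

definition Riesz_projection_bounded :: "real \<Rightarrow> bool" where
  "Riesz_projection_bounded p \<longleftrightarrow> (\<exists>C\<ge>0. \<forall>f g. poly g 0 = 0 \<longrightarrow>
     Lp_norm p (\<lambda>t. poly f (circle_point t))
       \<le> C * Lp_norm p (\<lambda>t. poly f (circle_point t) + cnj (poly g (circle_point t))))"

text \<open>
  For \<open>h = f + cnj g\<close> the real part of \<open>h\<close> is that of \<open>f + g\<close>, and the imaginary part of \<open>h\<close> is the
  real part of \<open>- \<i> (f - g)\<close>. So \<open>h\<close> controls these two analytic polynomials, up to imaginary
  constants, and they determine \<open>f\<close>. The constants are handled by \<open>f(0)\<close>, the mean of \<open>h\<close>.
\<close>

lemma Riesz_projection_bounded_le_2: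
  assumes pq: "conjugate_exponents p q" and "p \<le> 2"
  shows "Riesz_projection_bounded p"
proof -
  let ?M = "lebesgue_on {0..1::real}"
  have p: "p > 1" using pq by (simp add: conjugate_exponents_def)
  obtain C where C: "C \<ge> 0" and le: "\<And>F. Im (poly F 0) = 0 \<Longrightarrow>
       (\<integral>t. norm (poly F (circle_point t)) powr p \<partial>?M)
         \<le> C * (\<integral>t. \<bar>Re (poly F (circle_point t))\<bar> powr p \<partial>?M)"
    using Riesz_conjugate_function[OF p \<open>p \<le> 2\<close>] by blast
  define K where "K = 2 powr p * (C + 2 powr p * (C + 1))"
  have K: "K \<ge> 0" using C by (auto simp: K_def)
  have "Lp_norm p (\<lambda>t. poly f (circle_point t))
       \<le> K powr (1/p) * Lp_norm p (\<lambda>t. poly f (circle_point t) + cnj (poly g (circle_point t)))"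
    if g0: "poly g 0 = 0" for f g
  proof (rule Lp_norm_leI)
    define c where "c = poly f 0"
    define h where "h = (\<lambda>t. poly f (circle_point t) + cnj (poly g (circle_point t)))"
    define H where "H = (\<integral>t. norm (h t) powr p \<partial>?M)"
    have h: "bounded_measurable h"
      unfolding h_def by (intro bounded_measurable_intros bounded_measurable_poly)
    have inth: "integrable ?M (\<lambda>t. norm (h t) powr p)"
      using p by (intro integrable_bounded_measurable_powr h) auto
    have intp: "integrable ?M (\<lambda>t. norm (poly F (circle_point t)) powr p)" for F
      using p by (intro integrable_bounded_measurable_powr bounded_measurable_poly) auto
    have c: "norm c powr p \<le> H"
    proof -
      have "(\<integral>t. h t * 1 \<partial>?M) = c + cnj (poly g 0)"
        unfolding h_def c_def integral_poly_circle[symmetric]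
        by (simp add: integrable_bounded_measurable bounded_measurable_poly bounded_measurable_cnj)
      moreover have "norm (\<integral>t. h t * 1 \<partial>?M) \<le> Lp_norm p h * Lp_norm q (\<lambda>t. 1)"
        by (intro Hoelder_inequality pq h bounded_measurable_const)
      moreover have "Lp_norm q (\<lambda>t. 1) = 1" by (simp add: Lp_norm_def measure_restrict_space)
      ultimately have "norm c \<le> Lp_norm p h" using g0 by simp
      then have "norm c powr p \<le> Lp_norm p h powr p" using p by (intro powr_mono2) auto
      then show ?thesis using p by (simp add: Lp_norm_powr H_def)
    qed
    define U where "U = f + g - [:\<i> * of_real (Im c):]"
    define W where "W = smult (- \<i>) (f - g) + [:\<i> * of_real (Re c):]"
    have U: "(\<integral>t. norm (poly U (circle_point t)) powr p \<partial>?M) \<le> C * H"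
    proof -
      have "(\<integral>t. norm (poly U (circle_point t)) powr p \<partial>?M)
         \<le> C * (\<integral>t. \<bar>Re (poly U (circle_point t))\<bar> powr p \<partial>?M)"
        using g0 by (intro le) (simp add: U_def c_def)
      also have "\<dots> = C * (\<integral>t. \<bar>Re (h t)\<bar> powr p \<partial>?M)"
        by (simp add: U_def h_def)
      also have "\<dots> \<le> C * H"
        unfolding H_def
        using p abs_Re_le_cmod
        by (intro mult_left_mono C integral_mono' inth powr_mono2) auto
      finally show ?thesis .
    qed
    have W: "(\<integral>t. norm (poly W (circle_point t)) powr p \<partial>?M) \<le> C * H"
    proof -
      have "(\<integral>t. norm (poly W (circle_point t)) powr p \<partial>?M)
         \<le> C * (\<integral>t. \<bar>Re (poly W (circle_point t))\<bar> powr p \<partial>?M)"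
        using g0 by (intro le) (simp add: W_def c_def)
      also have "\<dots> = C * (\<integral>t. \<bar>Im (h t)\<bar> powr p \<partial>?M)"
        by (simp add: W_def h_def)
      also have "\<dots> \<le> C * H"
        unfolding H_def
        using p abs_Im_le_cmod
        by (intro mult_left_mono C integral_mono' inth powr_mono2) auto
      finally show ?thesis .
    qed
    have "(\<integral>t. norm (poly f (circle_point t)) powr p \<partial>?M)
      \<le> (\<integral>t. 2 powr p * (norm (poly U (circle_point t)) powr p
              + 2 powr p * (norm (poly W (circle_point t)) powr p + norm c powr p)) \<partial>?M)"
    proof (rule integral_mono)
      fix t
      let ?z = "circle_point t"
      have "2 * poly f ?z = poly U ?z + \<i> * poly W ?z + c"
        by (simp add: U_def W_def complex_eq_iff)
      then have "norm (2 * poly f ?z) \<le> norm (poly U ?z) + (norm (poly W ?z) + norm c)"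
        using norm_triangle_ineq[of "poly U ?z + \<i> * poly W ?z" c]
          norm_triangle_ineq[of "poly U ?z" "\<i> * poly W ?z"] by (simp add: norm_mult)
      then have "norm (poly f ?z) \<le> norm (poly U ?z) + (norm (poly W ?z) + norm c)"
        using norm_ge_zero[of "poly f ?z"] unfolding norm_mult norm_numeral by linarith
      then have "norm (poly f ?z) powr p \<le> (norm (poly U ?z) + (norm (poly W ?z) + norm c)) powr p"
        using p by (intro powr_mono2) auto
      also have "\<dots> \<le> 2 powr p * (norm (poly U ?z) powr p + (norm (poly W ?z) + norm c) powr p)"
        using p by (intro powr_add_le) auto
      also have "\<dots> \<le> 2 powr p * (norm (poly U ?z) powr p
              + 2 powr p * (norm (poly W ?z) powr p + norm c powr p))"
        using p by (intro mult_left_mono add_left_mono powr_add_le) auto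
      finally show "norm (poly f ?z) powr p \<le> 2 powr p * (norm (poly U ?z) powr p
              + 2 powr p * (norm (poly W ?z) powr p + norm c powr p))" .
    qed (use intp in auto)
    also have "\<dots> = 2 powr p * ((\<integral>t. norm (poly U (circle_point t)) powr p \<partial>?M)
         + 2 powr p * ((\<integral>t. norm (poly W (circle_point t)) powr p \<partial>?M) + norm c powr p))"
      using intp[of U] intp[of W] by (simp add: measure_restrict_space)
    also have "\<dots> \<le> 2 powr p * (C * H + 2 powr p * (C * H + H))"
      using U W c by (intro mult_left_mono add_mono) auto
    also have "\<dots> = (K powr (1/p)) powr p * Lp_norm p h powr p"
      using p K by (simp add: Lp_norm_powr H_def powr_powr) (simp add: K_def algebra_simps)
    also have "\<dots> = (K powr (1/p) * Lp_norm p h) powr p"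
      by (simp add: powr_mult Lp_norm_nonneg)
    finally show "(\<integral>t. norm (poly f (circle_point t)) powr p \<partial>?M) \<le> (K powr (1/p) *
      Lp_norm p (\<lambda>t. poly f (circle_point t) + cnj (poly g (circle_point t)))) powr p"
      by (simp add: h_def)
  qed (use p in \<open>auto simp: Lp_norm_nonneg\<close>)
  then show ?thesis
    unfolding Riesz_projection_bounded_def by (intro exI[of _ "K powr (1/p)"]) auto
qed

text \<open>
  The projection is self-adjoint for the pairing on the circle.
\<close>

lemma Riesz_projection_bounded_dual:
  assumes pq: "conjugate_exponents p q" and "Riesz_projection_bounded q"
  shows "Riesz_projection_bounded p"
proof -
  let ?M = "lebesgue_on {0..1::real}"
  obtain C where C: "C \<ge> 0" and le: "\<And>f g. poly g 0 = 0 \<Longrightarrow>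
     Lp_norm q (\<lambda>t. poly f (circle_point t))
       \<le> C * Lp_norm q (\<lambda>t. poly f (circle_point t) + cnj (poly g (circle_point t)))"
    using assms(2) by (auto simp: Riesz_projection_bounded_def)
  have "Lp_norm p (\<lambda>t. poly f (circle_point t))
       \<le> 8 * (C * Lp_norm p (\<lambda>t. poly f (circle_point t) + cnj (poly g (circle_point t))))"
    if g0: "poly g 0 = 0" for f g
  proof (rule Lp_norm_poly_le_by_duality[OF pq])
    define h where "h = (\<lambda>t. poly f (circle_point t) + cnj (poly g (circle_point t)))"
    have h: "bounded_measurable h"
      unfolding h_def by (intro bounded_measurable_intros bounded_measurable_poly)
    fix a b :: "complex poly" assume b: "poly b 0 = 0"
    have "(\<integral>t. h t * cnj (poly a (circle_point t)) \<partial>?M)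
       = (\<integral>t. poly f (circle_point t) * cnj (poly a (circle_point t)) \<partial>?M)
         + (\<integral>t. cnj (poly (g * a) (circle_point t)) \<partial>?M)"
      by (subst Bochner_Integration.integral_add[symmetric])
         (auto intro!: integrable_bounded_measurable bounded_measurable_intros bounded_measurable_poly
               simp: algebra_simps h_def simp del: poly_mult complex_cnj_mult, simp add: algebra_simps)
    also have "(\<integral>t. cnj (poly (g * a) (circle_point t)) \<partial>?M) = 0"
      unfolding Bochner_Integration.integral_cnj integral_poly_circle using g0 by simp
    finally have "norm (\<integral>t. poly f (circle_point t) * cnj (poly a (circle_point t)) \<partial>?M)
      = norm (\<integral>t. h t * cnj (poly a (circle_point t)) \<partial>?M)" by simp
    also have "\<dots> \<le> Lp_norm p h * Lp_norm q (\<lambda>t. cnj (poly a (circle_point t)))"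
      by (intro Hoelder_inequality pq h bounded_measurable_intros bounded_measurable_poly)
    also have "Lp_norm q (\<lambda>t. cnj (poly a (circle_point t))) = Lp_norm q (\<lambda>t. poly a (circle_point t))"
      by (simp add: Lp_norm_def)
    also have "Lp_norm p h * \<dots> \<le> Lp_norm p h *
        (C * Lp_norm q (\<lambda>t. poly a (circle_point t) + cnj (poly b (circle_point t))))"
      by (intro mult_left_mono le b Lp_norm_nonneg)
    finally show "norm (\<integral>t. poly f (circle_point t) * cnj (poly a (circle_point t)) \<partial>?M)
      \<le> C * Lp_norm p (\<lambda>t. poly f (circle_point t) + cnj (poly g (circle_point t)))
         * Lp_norm q (\<lambda>t. poly a (circle_point t) + cnj (poly b (circle_point t)))"
      by (simp add: h_def mult_ac)
  qed (simp add: C Lp_norm_nonneg)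
  then show ?thesis
    unfolding Riesz_projection_bounded_def using C by (intro exI[of _ "8 * C"]) (auto simp: mult.assoc)
qed

lemma Riesz_projection_bounded:
  assumes pq: "conjugate_exponents p q"
  shows "Riesz_projection_bounded p"
proof (cases "p \<le> 2")
  case True
  then show ?thesis using Riesz_projection_bounded_le_2[OF pq] by simp
next
  case False
  have "q > 1" "p > 1" "1/p + 1/q = 1" using pq by (auto simp: conjugate_exponents_def)
  moreover have "1 / p < 1 / 2" using False by simp
  ultimately have "1 / 2 < 1 / q" by linarith
  then have "q \<le> 2" using \<open>q > 1\<close> by (simp add: field_simps)
  then show ?thesis
    using Riesz_projection_bounded_dual[OF pq] Riesz_projection_bounded_le_2[of q p]
      conjugate_exponents_commute[OF pq] by blast
qed

section \<open>Walsh polynomials\<close>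

lemma finite_bits_nat: "finite {i. bit (n :: nat) i}"
proof (rule finite_subset)
  show "{i. bit n i} \<subseteq> {..<n}"
  proof
    fix i assume "i \<in> {i. bit n i}"
    then have "odd (n div 2 ^ i)" by (simp add: bit_iff_odd)
    then have "2 ^ i \<le> n" by (cases "2 ^ i \<le> n") auto
    moreover have "i < 2 ^ i" by (rule less_exp)
    ultimately have "i < n" by linarith
    then show "i \<in> {..<n}" by simp
  qed
qed simp

text \<open>
  The Rademacher functions vanish at dyadic points. Excluding all rational points is a convenient way
  of avoiding this.
\<close>

lemma rademacher_irrational:
  assumes "t \<notin> \<rat>"
  shows "rademacher i t = 1 \<or> rademacher i t = -1"
proof -
  have "sin (2 ^ (i + 1) * pi * t) \<noteq> 0"
  proof
    assume "sin (2 ^ (i + 1) * pi * t) = 0"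
    then obtain k :: int where "2 ^ (i + 1) * pi * t = of_int k * pi"
      by (auto simp: sin_zero_iff_int2)
    then have "2 ^ (i + 1) * t = of_int k" by simp
    then have "t = of_int k / 2 ^ (i + 1)" by (simp add: field_simps)
    then show False using assms by simp
  qed
  then show ?thesis by (simp add: rademacher_def sgn_real_def)
qed

lemma rademacher_add_1: "rademacher j (t + 1) = rademacher j t"
proof -
  have "sin (2 ^ (j + 1) * pi * (t + 1)) = sin (2 ^ (j + 1) * pi * t + 2 * real (2 ^ j) * pi)"
    by (simp add: algebra_simps)
  also have "\<dots> = sin (2 ^ (j + 1) * pi * t)"
    unfolding sin_add sin_2npi cos_2npi by simp
  finally show ?thesis by (simp add: rademacher_def)
qed

lemma rademacher_add_half_period: "rademacher i (t + 1 / 2 ^ (i + 1)) = - rademacher i t"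
proof -
  have "sin (2 ^ (i + 1) * pi * (t + 1 / 2 ^ (i + 1))) = sin (2 ^ (i + 1) * pi * t + pi)"
    by (intro arg_cong[of _ _ sin]) (simp add: field_simps)
  then show ?thesis by (simp add: rademacher_def sgn_minus)
qed

lemma rademacher_add_period:
  assumes "i < j"
  shows "rademacher j (t + 1 / 2 ^ (i + 1)) = rademacher j t"
proof -
  obtain d where j: "j = i + 1 + d" using assms by (metis add.assoc less_iff_Suc_add plus_1_eq_Suc add_Suc_right add.commute)
  have "sin (2 ^ (j + 1) * pi * (t + 1 / 2 ^ (i + 1))) = sin (2 ^ (j + 1) * pi * t + 2 * real (2 ^ d) * pi)"
    by (intro arg_cong[of _ _ sin]) (simp add: j field_simps power_add)
  also have "\<dots> = sin (2 ^ (j + 1) * pi * t)"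
    unfolding sin_add sin_2npi cos_2npi by simp
  finally show ?thesis by (simp add: rademacher_def)
qed

lemma bounded_measurable_walsh: "bounded_measurable (walsh n)"
proof -
  have "walsh n \<in> borel_measurable borel"
    unfolding walsh_def rademacher_def by measurable
  then have "walsh n \<in> borel_measurable (lebesgue_on {0..1})"
    by (intro measurable_restrict_space1 measurable_completion) simp
  moreover have "norm (walsh n t) \<le> 1" for t
  proof -
    have "norm (walsh n t) = (\<Prod>i\<in>{i. bit n i}. \<bar>rademacher i t\<bar>)"
      by (simp add: walsh_def abs_prod del: of_real_prod)
    also have "\<dots> \<le> 1"
      by (intro prod_le_1) (auto simp: rademacher_def sgn_real_def)
    finally show ?thesis .
  qed
  ultimately show ?thesis by (auto simp: bounded_measurable_def)
qed

lemma AE_irrational: "AE t in lebesgue_on {0..1::real}. t \<notin> \<rat>"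
proof -
  have "AE t in lborel. t \<notin> (\<rat> :: real set)"
    by (intro AE_not_in countable_imp_null_set_lborel countable_rat)
  then have "AE t in lebesgue. t \<notin> (\<rat> :: real set)"
    by (rule AE_completion)
  then show ?thesis
    by (subst AE_restrict_space_iff) auto
qed

text \<open>
  Translation by \<open>h\<close> preserves the mean of a function of period 1, and here it also changes the sign.
\<close>

lemma integral_antiperiodic_eq_0:
  fixes f :: "real \<Rightarrow> complex"
  assumes f: "bounded_measurable f" and per: "\<And>t. f (t + 1) = f t"
    and anti: "\<And>t. f (t + h) = - f t" and h: "0 \<le> h" "h \<le> 1"
  shows "(\<integral>t. f t \<partial>lebesgue_on {0..1}) = 0"
proof -
  have "f integrable_on {0..1}"
    using integrable_bounded_measurable[OF f] by (intro integrable_on_lebesgue_on) auto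
  then have int: "f integrable_on {a..b}" if "0 \<le> a" "b \<le> 1" for a b
    using integrable_subinterval_real[of f 0 1 a b] that by auto
  have "f \<circ> (+) h = (\<lambda>t. - f t)" by (auto simp: fun_eq_iff anti[symmetric] add.commute)
  then have 1: "integral {h..1} f = - integral {0..1 - h} f"
    using integral_shift_Icc_real[of 0 "1 - h" f h] by simp
  have "f (t + (h - 1)) = - f t" for t
    using per[of "t + (h - 1)"] anti[of t] by (simp add: add.commute)
  then have "f \<circ> (+) (h - 1) = (\<lambda>t. - f t)" by (auto simp: fun_eq_iff add.commute)
  then have 2: "integral {0..h} f = - integral {1 - h..1} f"
    using integral_shift_Icc_real[of "1 - h" 1 f "h - 1"] by simp
  have "integral {0..1} f = integral {0..h} f + integral {h..1} f"
    using h int by (intro Henstock_Kurzweil_Integration.integral_combine[symmetric]) auto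
  moreover have "integral {0..1} f = integral {0..1 - h} f + integral {1 - h..1} f"
    using h int by (intro Henstock_Kurzweil_Integration.integral_combine[symmetric]) auto
  ultimately have "integral {0..1} f = - integral {0..1} f"
    using 1 2 by simp
  then have "integral {0..1} f = 0" by simp
  then show ?thesis
    using integrable_bounded_measurable[OF f] by (simp add: lebesgue_integral_eq_integral)
qed

lemma walsh_0: "walsh 0 t = 1"
  by (simp add: walsh_def)

text \<open>
  Let \<open>i\<close> be the lowest binary digit of \<open>n\<close> that is set. Translation by half a period of the \<open>i\<close>-th
  Rademacher function flips its sign, and all other factors of \<open>walsh n\<close> oscillate faster and are
  invariant.
\<close>

lemma integral_walsh:
  assumes "n \<noteq> 0"
  shows "(\<integral>t. walsh n t \<partial>lebesgue_on {0..1}) = 0"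
proof -
  have "\<exists>i. bit n i" using assms by (metis bit_eqI bit_0_eq bot_apply bot_bool_def)
  define i where "i = (LEAST i. bit n i)"
  have i: "bit n i" "\<And>j. bit n j \<Longrightarrow> i \<le> j"
    unfolding i_def using \<open>\<exists>i. bit n i\<close> by (auto intro: LeastI_ex Least_le)
  show ?thesis
  proof (rule integral_antiperiodic_eq_0[OF bounded_measurable_walsh])
    show "walsh n (t + 1) = walsh n t" for t
      by (simp only: walsh_def rademacher_add_1)
    show "walsh n (t + 1 / 2 ^ (i + 1)) = - walsh n t" for t
    proof -
      have "(\<Prod>j\<in>{j. bit n j}. rademacher j (t + 1 / 2 ^ (i + 1)))
          = rademacher i (t + 1 / 2 ^ (i + 1)) * (\<Prod>j\<in>{j. bit n j} - {i}. rademacher j (t + 1 / 2 ^ (i + 1)))"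
        using i finite_bits_nat by (intro prod.remove) auto
      also have "(\<Prod>j\<in>{j. bit n j} - {i}. rademacher j (t + 1 / 2 ^ (i + 1)))
          = (\<Prod>j\<in>{j. bit n j} - {i}. rademacher j t)"
        using i by (intro prod.cong rademacher_add_period) (auto simp: order_less_le)
      also have "rademacher i (t + 1 / 2 ^ (i + 1)) * \<dots> = - (\<Prod>j\<in>{j. bit n j}. rademacher j t)"
        using i finite_bits_nat prod.remove[of "{j. bit n j}" i "\<lambda>j. rademacher j t"]
        by (simp only: rademacher_add_half_period) simp
      finally show ?thesis by (simp only: walsh_def of_real_minus)
    qed
    show "1 / 2 ^ (i + 1) \<le> (1 :: real)"
      using one_le_power[of "2 :: real" "i + 1"] by (simp add: field_simps)
  qed simp
qed

text \<open>
  The digits common to \<open>m\<close> and \<open>n\<close> contribute squares of Rademacher functions.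
\<close>

lemma walsh_mult:
  assumes "t \<notin> \<rat>"
  shows "walsh m t * walsh n t = walsh (xor m n) t"
proof -
  let ?r = "\<lambda>i. rademacher i t"
  have sq: "?r i * ?r i = 1" for i using rademacher_irrational[OF assms, of i] by auto
  have eq: "{i. bit m i} = {i. bit m i \<and> \<not> bit n i} \<union> {i. bit m i \<and> bit n i}"
    "{i. bit n i} = {i. bit n i \<and> \<not> bit m i} \<union> {i. bit m i \<and> bit n i}"
    "{i. bit (xor m n) i} = {i. bit m i \<and> \<not> bit n i} \<union> {i. bit n i \<and> \<not> bit m i}"
    by (auto simp: bit_xor_iff)
  have fin: "finite {i. bit m i \<and> \<not> bit n i}" "finite {i. bit n i \<and> \<not> bit m i}" "finite {i. bit m i \<and> bit n i}"
    using finite_bits_nat[of m] finite_bits_nat[of n] by (auto intro: finite_subset)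
  have "prod ?r {i. bit m i} * prod ?r {i. bit n i}
    = prod ?r {i. bit m i \<and> \<not> bit n i} * prod ?r {i. bit n i \<and> \<not> bit m i}
      * (prod ?r {i. bit m i \<and> bit n i} * prod ?r {i. bit m i \<and> bit n i})"
    by (subst eq(1), subst eq(2), subst (1 2) prod.union_disjoint) (use fin in auto)
  also have "prod ?r {i. bit m i \<and> bit n i} * prod ?r {i. bit m i \<and> bit n i} = 1"
    by (simp add: prod.distrib[symmetric] sq)
  also have "prod ?r {i. bit m i \<and> \<not> bit n i} * prod ?r {i. bit n i \<and> \<not> bit m i} * 1
      = prod ?r {i. bit (xor m n) i}"
    unfolding eq(3) by (subst prod.union_disjoint) (use fin in auto)
  finally show ?thesis by (simp only: walsh_def of_real_mult[symmetric])
qed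

lemma walsh_orthonormal:
  "(\<integral>t. walsh m t * cnj (walsh n t) \<partial>lebesgue_on {0..1}) = of_bool (m = n)"
proof -
  have "(\<integral>t. walsh m t * cnj (walsh n t) \<partial>lebesgue_on {0..1})
      = (\<integral>t. walsh (xor m n) t \<partial>lebesgue_on {0..1})"
  proof (rule integral_cong_AE)
    show "AE t in lebesgue_on {0..1}. walsh m t * cnj (walsh n t) = walsh (xor m n) t"
      using AE_irrational
    proof eventually_elim
      case (elim t)
      then show ?case using walsh_mult[OF elim] by (simp add: walsh_def)
    qed
  qed (auto intro!: bounded_measurable_measurable bounded_measurable_intros bounded_measurable_walsh)
  also have "\<dots> = of_bool (m = n)"
  proof (cases "m = n")
    case True
    then show ?thesis by (simp add: walsh_0 measure_restrict_space)
  next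
    case False
    then have "xor m n \<noteq> 0" by (metis bit_0_eq bit_eqI bit_xor_iff bot_apply bot_bool_def)
    then show ?thesis using False by (simp add: integral_walsh)
  qed
  finally show ?thesis .
qed

text \<open>
  Values at rational points are ignored: products of Walsh functions are again Walsh functions only
  outside the zeros of the Rademacher functions.
\<close>

definition walsh_polynomial :: "(real \<Rightarrow> complex) \<Rightarrow> bool" where
  "walsh_polynomial f \<longleftrightarrow>
     (\<exists>c. finite {k. c k \<noteq> 0} \<and> (\<forall>t. t \<notin> \<rat> \<longrightarrow> f t = (\<Sum>k | c k \<noteq> 0. c k * walsh k t)))"

lemma walsh_polynomialI:
  assumes "finite A" "\<And>t. t \<notin> \<rat> \<Longrightarrow> f t = (\<Sum>k\<in>A. c k * walsh k t)"
  shows "walsh_polynomial f"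
proof -
  define d where "d k = (if k \<in> A then c k else 0)" for k
  have sub: "{k. d k \<noteq> 0} \<subseteq> A" by (auto simp: d_def)
  have "f t = (\<Sum>k | d k \<noteq> 0. d k * walsh k t)" if "t \<notin> \<rat>" for t
    unfolding assms(2)[OF that]
    using sub assms(1) by (intro sum.mono_neutral_cong_right) (auto simp: d_def)
  then show ?thesis
    unfolding walsh_polynomial_def using finite_subset[OF sub assms(1)] by blast
qed

lemma walsh_polynomial_walsh: "walsh_polynomial (\<lambda>t. a * walsh k t)"
  by (rule walsh_polynomialI[of "{k}" _ "\<lambda>_. a"]) auto

lemma walsh_polynomial_add:
  assumes "walsh_polynomial f" "walsh_polynomial g"
  shows "walsh_polynomial (\<lambda>t. f t + g t)"
proof -
  obtain c where c: "finite {k. c k \<noteq> 0}" "\<And>t. t \<notin> \<rat> \<Longrightarrow> f t = (\<Sum>k | c k \<noteq> 0. c k * walsh k t)"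
    using assms by (auto simp: walsh_polynomial_def)
  obtain d where d: "finite {k. d k \<noteq> 0}" "\<And>t. t \<notin> \<rat> \<Longrightarrow> g t = (\<Sum>k | d k \<noteq> 0. d k * walsh k t)"
    using assms by (auto simp: walsh_polynomial_def)
  let ?A = "{k. c k \<noteq> 0} \<union> {k. d k \<noteq> 0}"
  show ?thesis
  proof (rule walsh_polynomialI[of ?A _ "\<lambda>k. c k + d k"])
    fix t :: real assume t: "t \<notin> \<rat>"
    have "f t = (\<Sum>k\<in>?A. c k * walsh k t)" "g t = (\<Sum>k\<in>?A. d k * walsh k t)"
      unfolding c(2)[OF t] d(2)[OF t] using c(1) d(1) by (auto intro!: sum.mono_neutral_left)
    then show "f t + g t = (\<Sum>k\<in>?A. (c k + d k) * walsh k t)"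
      by (simp add: sum.distrib algebra_simps)
  qed (use c d in auto)
qed

lemma walsh_polynomial_sum:
  "(\<And>x. x \<in> A \<Longrightarrow> walsh_polynomial (f x)) \<Longrightarrow> walsh_polynomial (\<lambda>t. \<Sum>x\<in>A. f x t)"
proof (induction A rule: infinite_finite_induct)
  case (insert x A)
  then show ?case by (simp add: walsh_polynomial_add)
qed (use walsh_polynomial_walsh[of 0 0] in simp_all)

lemma walsh_polynomial_mult:
  assumes "walsh_polynomial f" "walsh_polynomial g"
  shows "walsh_polynomial (\<lambda>t. f t * g t)"
proof -
  obtain c where c: "\<And>t. t \<notin> \<rat> \<Longrightarrow> f t = (\<Sum>k | c k \<noteq> 0. c k * walsh k t)"
    using assms by (auto simp: walsh_polynomial_def)
  obtain d where d: "\<And>t. t \<notin> \<rat> \<Longrightarrow> g t = (\<Sum>k | d k \<noteq> 0. d k * walsh k t)"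
    using assms by (auto simp: walsh_polynomial_def)
  have "walsh_polynomial (\<lambda>t. \<Sum>k | c k \<noteq> 0. \<Sum>l | d l \<noteq> 0. (c k * d l) * walsh (xor k l) t)"
    by (intro walsh_polynomial_sum walsh_polynomial_walsh)
  moreover have "f t * g t = (\<Sum>k | c k \<noteq> 0. \<Sum>l | d l \<noteq> 0. (c k * d l) * walsh (xor k l) t)"
    if "t \<notin> \<rat>" for t
    by (simp add: c[OF that] d[OF that] sum_product walsh_mult[OF that, symmetric] mult_ac)
  ultimately show ?thesis by (simp add: walsh_polynomial_def)
qed

lemma walsh_polynomial_poly:
  assumes "walsh_polynomial f"
  shows "walsh_polynomial (\<lambda>t. poly q (f t))"
proof (induction q)
  case 0
  then show ?case using walsh_polynomial_walsh[of 0 0] by simp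
next
  case (pCons a q)
  have "walsh_polynomial (\<lambda>t. a * walsh 0 t + f t * poly q (f t))"
    by (intro walsh_polynomial_add walsh_polynomial_walsh walsh_polynomial_mult assms pCons)
  then show ?case by (simp add: walsh_0)
qed

lemma finite_range_walsh_polynomial:
  assumes "walsh_polynomial f"
  shows "finite (f ` (- \<rat>))"
proof -
  obtain c where c: "finite {k. c k \<noteq> 0}" "\<And>t. t \<notin> \<rat> \<Longrightarrow> f t = (\<Sum>k | c k \<noteq> 0. c k * walsh k t)"
    using assms by (auto simp: walsh_polynomial_def)
  have w: "walsh k t \<in> {1, -1}" if "t \<notin> \<rat>" for k t
  proof -
    have "walsh k t * walsh k t = walsh 0 t"
      using walsh_mult[OF that, of k k] by simp
    then show ?thesis by (simp add: walsh_0 square_eq_1_iff)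
  qed
  have "finite ((\<lambda>t. \<Sum>k\<in>A. c k * walsh k t) ` (- \<rat>))" if "finite A" for A
    using that
  proof induction
    case (insert k A)
    have "(\<lambda>t. \<Sum>k\<in>insert k A. c k * walsh k t) ` (- \<rat>)
       \<subseteq> (\<lambda>(x, y). c k * x + y) ` ({1, -1} \<times> (\<lambda>t. \<Sum>k\<in>A. c k * walsh k t) ` (- \<rat>))"
      using insert w by (force simp: image_iff)
    then show ?case
      using insert by (meson finite.emptyI finite.insertI finite_SigmaI finite_imageI finite_subset)
  next
    case empty
    show ?case by (rule finite_subset[of _ "{0}"]) auto
  qed
  from this[OF c(1)] show ?thesis
    by (rule finite_subset[rotated]) (auto simp: c(2))
qed

lemma interpolating_poly:
  fixes \<phi> :: "complex \<Rightarrow> complex"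
  assumes "finite S"
  shows "\<exists>q. \<forall>x\<in>S. poly q x = \<phi> x"
  using assms
proof induction
  case (insert a S)
  then obtain q where q: "\<forall>x\<in>S. poly q x = \<phi> x" by blast
  define r where "r = (\<Prod>s\<in>S. [:- s, 1:])"
  have r: "poly r a \<noteq> 0" "\<forall>x\<in>S. poly r x = 0"
    using insert by (auto simp: r_def poly_prod)
  show ?case
    using q r by (intro exI[of _ "q + smult ((\<phi> a - poly q a) / poly r a) r"]) auto
qed simp

text \<open>
  On its finitely many values \<open>\<phi>\<close> agrees with an interpolating polynomial, and the Walsh
  polynomials form an algebra.
\<close>

lemma walsh_polynomial_compose:
  assumes "walsh_polynomial f"
  shows "walsh_polynomial (\<lambda>t. \<phi> (f t))"
proof -
  obtain q where "\<forall>x \<in> f ` (- \<rat>). poly q x = \<phi> x"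
    using interpolating_poly[OF finite_range_walsh_polynomial[OF assms]] by blast
  then have "\<phi> (f t) = poly q (f t)" if "t \<notin> \<rat>" for t
    using that by auto
  then show ?thesis
    using walsh_polynomial_poly[OF assms, of q] by (simp add: walsh_polynomial_def)
qed

section \<open>Equivalence of the two systems\<close>

definition combination :: "(nat \<Rightarrow> real \<Rightarrow> complex) \<Rightarrow> (nat \<Rightarrow> complex) \<Rightarrow> real \<Rightarrow> complex" where
  "combination a \<xi> t = (\<Sum>k | \<xi> k \<noteq> 0. \<xi> k * a k t)"

lemma bounded_measurable_combination:
  "(\<And>k. bounded_measurable (a k)) \<Longrightarrow> bounded_measurable (combination a \<xi>)"
  unfolding combination_def by (intro bounded_measurable_intros)

lemma integral_combination_orthonormal:
  assumes bm: "\<And>k. bounded_measurable (a k)"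
    and orth: "\<And>k l. (\<integral>t. a k t * cnj (a l t) \<partial>lebesgue_on {0..1}) = of_bool (k = l)"
    and fin: "finite {k. \<xi> k \<noteq> 0}" "finite {k. \<eta> k \<noteq> 0}"
  shows "(\<integral>t. combination a \<xi> t * cnj (combination a \<eta> t) \<partial>lebesgue_on {0..1})
    = (\<Sum>k | \<xi> k \<noteq> 0. \<xi> k * cnj (\<eta> k))"
proof -
  let ?M = "lebesgue_on {0..1::real}"
  have int: "integrable ?M (\<lambda>t. a k t * cnj (a l t))" for k l
    by (intro integrable_bounded_measurable bounded_measurable_intros bm)
  have "(\<integral>t. combination a \<xi> t * cnj (combination a \<eta> t) \<partial>?M)
     = (\<integral>t. (\<Sum>k | \<xi> k \<noteq> 0. \<Sum>l | \<eta> l \<noteq> 0. \<xi> k * cnj (\<eta> l) * (a k t * cnj (a l t))) \<partial>?M)"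
    by (simp add: combination_def sum_product cnj_sum mult_ac)
  also have "\<dots> = (\<Sum>k | \<xi> k \<noteq> 0. \<Sum>l | \<eta> l \<noteq> 0. \<xi> k * cnj (\<eta> l) * of_bool (k = l))"
    using int by (subst Bochner_Integration.integral_sum; simp add: orth)+
  also have "\<dots> = (\<Sum>k | \<xi> k \<noteq> 0. \<xi> k * cnj (\<eta> k))"
    using fin by (intro sum.cong refl) (simp add: of_bool_def if_distrib sum.delta cong: if_cong)
  finally show ?thesis .
qed

lemma combination_trig_eq_poly:
  assumes "finite {k. \<xi> k \<noteq> 0}"
  obtains f where "combination trig \<xi> = (\<lambda>t. poly f (circle_point t))"
proof
  show "combination trig \<xi> = (\<lambda>t. poly (\<Sum>k | \<xi> k \<noteq> 0. monom (\<xi> k) k) (circle_point t))"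
    by (simp add: fun_eq_iff combination_def trig_eq_power poly_sum poly_monom)
qed

lemma poly_eq_combination_trig:
  "(\<lambda>t. poly f (circle_point t)) = combination trig (coeff f)" "finite {k. coeff f k \<noteq> 0}"
proof -
  have sub: "{k. coeff f k \<noteq> 0} \<subseteq> {..degree f}" by (auto intro: le_degree)
  then show "finite {k. coeff f k \<noteq> 0}" by (rule finite_subset) simp
  show "(\<lambda>t. poly f (circle_point t)) = combination trig (coeff f)"
    unfolding combination_def trig_eq_power poly_altdef
    using sub by (intro ext sum.mono_neutral_right) auto
qed

lemma bounded_measurable_trig: "bounded_measurable (trig k)"
  using bounded_measurable_poly[of "monom 1 k"]
  by (simp add: trig_eq_power[abs_def] poly_monom)

lemma trig_orthonormal:
  "(\<integral>t. trig k t * cnj (trig l t) \<partial>lebesgue_on {0..1}) = of_bool (k = l)"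
proof -
  have cancel: "z ^ n * cnj z ^ n = 1" if "norm z = 1" for z :: complex and n
    using that by (simp add: power_mult_distrib[symmetric] complex_norm_square[symmetric])
  have le: "(\<integral>t. trig k t * cnj (trig l t) \<partial>lebesgue_on {0..1}) = of_bool (k = l)" if "l \<le> k" for k l
  proof -
    have "trig k t * cnj (trig l t) = poly (monom 1 (k - l)) (circle_point t)" for t
    proof -
      have "trig k t = circle_point t ^ (k - l) * circle_point t ^ l"
        using that by (simp add: trig_eq_power power_add[symmetric])
      then show ?thesis
        by (simp add: trig_eq_power poly_monom mult.assoc cancel)
    qed
    then show ?thesis
      using that by (simp only: integral_poly_circle) (auto simp: poly_monom power_0_left)
  qed
  show ?thesis
  proof (cases "l \<le> k")
    case False
    then have "cnj (\<integral>t. trig l t * cnj (trig k t) \<partial>lebesgue_on {0..1}) = of_bool (k = l)"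
      by (subst le) auto
    then show ?thesis
      by (simp add: Bochner_Integration.integral_cnj[symmetric] mult.commute)
  qed (rule le)
qed

text \<open>
  Here surjectivity of \<open>\<sigma>\<close> enters: no Walsh function is left out by the rearranged system.
\<close>

lemma walsh_polynomial_eq_combination:
  assumes \<sigma>: "bij \<sigma>" and f: "walsh_polynomial f"
  obtains \<eta> where "finite {k. \<eta> k \<noteq> 0}" "\<And>t. t \<notin> \<rat> \<Longrightarrow> f t = combination (\<lambda>k. walsh (\<sigma> k)) \<eta> t"
proof -
  obtain c where c: "finite {k. c k \<noteq> 0}" "\<And>t. t \<notin> \<rat> \<Longrightarrow> f t = (\<Sum>k | c k \<noteq> 0. c k * walsh k t)"
    using f by (auto simp: walsh_polynomial_def)
  have bij: "bij_betw \<sigma> {k. c (\<sigma> k) \<noteq> 0} {k. c k \<noteq> 0}"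
    using bij_betw_subset[OF \<sigma>, of "{k. c (\<sigma> k) \<noteq> 0}"] bij_is_surj[OF \<sigma>]
    by (auto simp: bij_betw_def inj_on_def bij_def surj_def image_iff)
  show thesis
  proof (rule that[of "\<lambda>k. c (\<sigma> k)"])
    show "finite {k. c (\<sigma> k) \<noteq> 0}" using bij_betw_finite[OF bij] c by simp
    show "f t = combination (\<lambda>k. walsh (\<sigma> k)) (\<lambda>k. c (\<sigma> k)) t" if "t \<notin> \<rat>" for t
      unfolding combination_def c(2)[OF that] by (rule sum.reindex_bij_betw[OF bij, symmetric])
  qed
qed

lemma walsh_polynomial_combination:
  "finite {k. \<xi> k \<noteq> 0} \<Longrightarrow> walsh_polynomial (combination (\<lambda>k. walsh (\<sigma> k)) \<xi>)"
  unfolding combination_def by (intro walsh_polynomial_sum walsh_polynomial_walsh)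

text \<open>
  The equality \<open>pair\<close> of the two pairings transports test functions. For \<open>upper\<close> the test function of
  \<open>W \<xi>\<close> is some \<open>W \<eta>\<close>, and it is replaced by \<open>E \<eta>\<close>. For \<open>lower\<close> a trigonometric test function of
  \<open>E \<xi>\<close> is first cut down to its analytic part \<open>a\<close> by the Riesz projection, and then \<open>a\<close> is replaced by
  the Walsh polynomial with the same coefficients.
\<close>

lemma equivalent_in_Lp_trig_walsh_dual:
  assumes \<sigma>: "bij \<sigma>" and pq: "conjugate_exponents p q"
    and equiv: "equivalent_in_Lp p trig (\<lambda>k. walsh (\<sigma> k))"
  shows "equivalent_in_Lp q trig (\<lambda>k. walsh (\<sigma> k))"
proof -
  let ?M = "lebesgue_on {0..1::real}"
  have p: "p > 1" "q > 1" using pq by (auto simp: conjugate_exponents_def)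
  have qp: "conjugate_exponents q p" by (rule conjugate_exponents_commute[OF pq])
  define E where "E = combination trig"
  define W where "W = combination (\<lambda>k. walsh (\<sigma> k))"
  have bE: "bounded_measurable (E \<xi>)" for \<xi>
    unfolding E_def by (intro bounded_measurable_combination bounded_measurable_trig)
  have bW: "bounded_measurable (W \<xi>)" for \<xi>
    unfolding W_def by (intro bounded_measurable_combination bounded_measurable_walsh)
  have inj: "\<sigma> k = \<sigma> l \<longleftrightarrow> k = l" for k l using \<sigma> by (auto simp: bij_def inj_def)
  have pair: "(\<integral>t. E \<xi> t * cnj (E \<eta> t) \<partial>?M) = (\<integral>t. W \<xi> t * cnj (W \<eta> t) \<partial>?M)"
    if "finite {k. \<xi> k \<noteq> 0}" "finite {k. \<eta> k \<noteq> 0}" for \<xi> \<eta>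
    unfolding E_def W_def using that
    by (simp add: integral_combination_orthonormal bounded_measurable_trig bounded_measurable_walsh
        trig_orthonormal walsh_orthonormal inj)
  have cnj: "Lp_norm r (\<lambda>t. cnj (f t)) = Lp_norm r f" for r f by (simp add: Lp_norm_def)
  obtain c where c: "c > 0"
    and EW: "\<And>\<xi>. finite {k. \<xi> k \<noteq> 0} \<Longrightarrow> Lp_norm p (E \<xi>) \<le> c * Lp_norm p (W \<xi>)"
    and WE: "\<And>\<xi>. finite {k. \<xi> k \<noteq> 0} \<Longrightarrow> Lp_norm p (W \<xi>) \<le> c * Lp_norm p (E \<xi>)"
  proof -
    obtain c where c: "c > 0" "\<forall>\<xi>. finite {k. \<xi> k \<noteq> 0} \<longrightarrow>
       1 / c * Lp_norm p (E \<xi>) \<le> Lp_norm p (W \<xi>) \<and> Lp_norm p (W \<xi>) \<le> c * Lp_norm p (E \<xi>)"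
      using equiv unfolding equivalent_in_Lp_def E_def W_def combination_def[abs_def] by blast
    show thesis
      by (rule that[of c]) (use c in \<open>auto simp: field_simps\<close>)
  qed
  obtain C where C: "C \<ge> 0" and Riesz: "\<And>f g. poly g 0 = 0 \<Longrightarrow>
     Lp_norm p (\<lambda>t. poly f (circle_point t))
       \<le> C * Lp_norm p (\<lambda>t. poly f (circle_point t) + cnj (poly g (circle_point t)))"
    using Riesz_projection_bounded[OF pq] by (auto simp: Riesz_projection_bounded_def)
  have upper: "Lp_norm q (W \<xi>) \<le> 8 * (c * Lp_norm q (E \<xi>))" if \<xi>: "finite {k. \<xi> k \<noteq> 0}" for \<xi>
  proof (rule Lp_norm_le_by_duality[OF qp bW])
    fix e :: real assume "e > 0"
    have "walsh_polynomial (\<lambda>t. duality_map q (W \<xi> t))"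
      unfolding W_def
      by (rule walsh_polynomial_compose[OF walsh_polynomial_combination[OF \<xi>]])
    then obtain \<eta> where \<eta>: "finite {k. \<eta> k \<noteq> 0}"
      and eq: "\<And>t. t \<notin> \<rat> \<Longrightarrow> duality_map q (W \<xi> t) = W \<eta> t"
      using walsh_polynomial_eq_combination[OF \<sigma>] unfolding W_def by blast
    have "norm (\<integral>t. W \<xi> t * cnj (W \<eta> t) \<partial>?M) = norm (\<integral>t. E \<xi> t * cnj (E \<eta> t) \<partial>?M)"
      by (simp add: pair \<xi> \<eta>)
    also have "\<dots> \<le> Lp_norm q (E \<xi>) * Lp_norm p (\<lambda>t. cnj (E \<eta> t))"
      by (intro Hoelder_inequality qp bE bounded_measurable_cnj)
    also have "\<dots> \<le> Lp_norm q (E \<xi>) * (c * Lp_norm p (W \<eta>))"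
      unfolding cnj by (intro mult_left_mono EW \<eta> Lp_norm_nonneg)
    finally have "norm (\<integral>t. W \<xi> t * cnj (W \<eta> t) \<partial>?M) \<le> c * Lp_norm q (E \<xi>) * Lp_norm p (W \<eta>)"
      by (simp add: mult_ac)
    moreover have "AE t in ?M. norm (W \<eta> t - duality_map q (W \<xi> t)) \<le> e"
      using AE_irrational by eventually_elim (use eq \<open>e > 0\<close> in auto)
    ultimately show "\<exists>g. bounded_measurable g \<and>
        (AE t in ?M. norm (g t - duality_map q (W \<xi> t)) \<le> e) \<and>
        norm (\<integral>t. W \<xi> t * cnj (g t) \<partial>?M) \<le> c * Lp_norm q (E \<xi>) * Lp_norm p g"
      using bW by blast
  qed (use c in \<open>simp add: Lp_norm_nonneg\<close>)
  have lower: "Lp_norm q (E \<xi>) \<le> 8 * (c * C * Lp_norm q (W \<xi>))" if \<xi>: "finite {k. \<xi> k \<noteq> 0}" for \<xi>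
  proof -
    obtain f where f: "E \<xi> = (\<lambda>t. poly f (circle_point t))"
      unfolding E_def using combination_trig_eq_poly[OF \<xi>] by blast
    show ?thesis
      unfolding f
    proof (rule Lp_norm_poly_le_by_duality[OF qp])
      fix a b :: "complex poly" assume b: "poly b 0 = 0"
      let ?h = "\<lambda>t. poly a (circle_point t) + cnj (poly b (circle_point t))"
      have a: "(\<lambda>t. poly a (circle_point t)) = E (coeff a)" "finite {k. coeff a k \<noteq> 0}"
        unfolding E_def by (rule poly_eq_combination_trig)+
      have "norm (\<integral>t. poly f (circle_point t) * cnj (poly a (circle_point t)) \<partial>?M)
         = norm (\<integral>t. E \<xi> t * cnj (E (coeff a) t) \<partial>?M)"
        unfolding f a(1)[symmetric] ..
      also have "\<dots> = norm (\<integral>t. W \<xi> t * cnj (W (coeff a) t) \<partial>?M)"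
        by (simp add: pair \<xi> a)
      also have "\<dots> \<le> Lp_norm q (W \<xi>) * Lp_norm p (\<lambda>t. cnj (W (coeff a) t))"
        by (intro Hoelder_inequality qp bW bounded_measurable_cnj)
      also have "\<dots> \<le> Lp_norm q (W \<xi>) * (c * (C * Lp_norm p ?h))"
      proof (intro mult_left_mono Lp_norm_nonneg)
        have "Lp_norm p (W (coeff a)) \<le> c * Lp_norm p (E (coeff a))"
          by (rule WE[OF a(2)])
        also have "\<dots> \<le> c * (C * Lp_norm p ?h)"
          unfolding a(1)[symmetric] using c by (intro mult_left_mono Riesz b) auto
        finally show "Lp_norm p (\<lambda>t. cnj (W (coeff a) t)) \<le> c * (C * Lp_norm p ?h)"
          by (simp add: cnj)
      qed
      finally show "norm (\<integral>t. poly f (circle_point t) * cnj (poly a (circle_point t)) \<partial>?M)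
         \<le> c * C * Lp_norm q (W \<xi>) * Lp_norm p ?h" by (simp add: mult_ac)
    qed (use c C in \<open>simp add: Lp_norm_nonneg\<close>)
  qed
  define D where "D = 8 * c * (C + 1)"
  have D: "D > 0" using c C by (simp add: D_def)
  have "1 / D * Lp_norm q (E \<xi>) \<le> Lp_norm q (W \<xi>) \<and> Lp_norm q (W \<xi>) \<le> D * Lp_norm q (E \<xi>)"
    if \<xi>: "finite {k. \<xi> k \<noteq> 0}" for \<xi>
  proof
    have "8 * c * C * Lp_norm q (W \<xi>) \<le> D * Lp_norm q (W \<xi>)"
      unfolding D_def using c C by (intro mult_right_mono Lp_norm_nonneg) (simp add: algebra_simps)
    then have "Lp_norm q (E \<xi>) \<le> D * Lp_norm q (W \<xi>)"
      using lower[OF \<xi>] by simp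
    then show "1 / D * Lp_norm q (E \<xi>) \<le> Lp_norm q (W \<xi>)" using D by (simp add: field_simps)
    have "8 * c * Lp_norm q (E \<xi>) \<le> D * Lp_norm q (E \<xi>)"
      unfolding D_def using c C by (intro mult_right_mono Lp_norm_nonneg) (simp add: algebra_simps)
    then show "Lp_norm q (W \<xi>) \<le> D * Lp_norm q (E \<xi>)"
      using upper[OF \<xi>] by simp
  qed
  moreover have "in_Lp q (trig k)" "in_Lp q (walsh (\<sigma> k))" for k
    using p by (auto intro!: bounded_measurable_in_Lp bounded_measurable_trig bounded_measurable_walsh)
  ultimately show ?thesis
    unfolding equivalent_in_Lp_def E_def W_def combination_def[abs_def] using D by blast
qed

theorem proposition2p5:
  fixes \<sigma> :: "nat \<Rightarrow> nat" and p p' :: real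
  assumes "bij \<sigma>"
    and "1 < p"
    and "1 / p + 1 / p' = 1"
  shows "equivalent_in_Lp p trig (\<lambda>k. walsh (\<sigma> k)) \<longleftrightarrow>
         equivalent_in_Lp p' trig (\<lambda>k. walsh (\<sigma> k))"
proof -
  have "0 < 1 / p" "1 / p < 1" using assms(2) by simp_all
  with assms(3) have "0 < 1 / p'" "1 / p' < 1" by linarith+
  then have "1 < p'" by (simp add: divide_less_eq)
  then have "conjugate_exponents p p'" using assms by (simp add: conjugate_exponents_def)
  then show ?thesis
    using equivalent_in_Lp_trig_walsh_dual[OF assms(1)] conjugate_exponents_commute by blast
qed

end
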